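(* Let $(\Omega,\mathcal E,P)$ be a probability space and $\mathcal F$ a $\sigma$-subalgebra of $\mathcal E$. For each $p\in[1,+\infty]$, $(L^p_{\mathcal F}(\mathcal E),\mathcal T_c)$ is $L^0$-pre-barreled, where $\mathcal T_c$ is the locally $L^0$-convex topology induced by the $L^0$-norm $|||\cdot|||_p$.
   Context: $L^0(\mathcal E)$, $L^0(\mathcal F)$ are the algebras of (a.s.-equality) equivalence classes of real $\mathcal E$-, respectively $\mathcal F$-, measurable random variables with the a.s. order; $L^0_+(\mathcal F)$ and $L^0_{++}(\mathcal F)$ are the elements of $L^0(\mathcal F)$ that are $\ge0$, respectively $>0$, a.s.; $\bar L^0_+(\mathcal F)$ is the set of classes of $[0,\infty]$-valued $\mathcal F$-measurable functions. $\tilde I_A$ is the class of the indicator of $A$. For $x\in L^0(\mathcal E)$ put $|||x|||_p=E[|x|^p\,|\,\mathcal F]^{1/p}$ if $1\le p<\infty$, and $|||x|||_\infty=\bigwedge\{\xi\in\bar L^0_+(\mathcal F):|x|\le\xi\}$. $L^p_{\mathcal F}(\mathcal E)=\{x\in L^0(\mathcal E):|||x|||_p\in L^0_+(\mathcal F)\}$, an $L^0(\mathcal F)$-module. The topology $\mathcal T_c$ has local base at $0$ consisting of $\{x:|||x|||_p\le\varepsilon\}$, $\varepsilon\in L^0_{++}(\mathcal F)$. In an $L^0(\mathcal F)$-module $E$: a set $B$ is $L^0$-balanced if $\eta B\subset B$ for all $\eta\in L^0(\mathcal F)$ with $|\eta|\le1$; $L^0$-convex if $\xi x+(1-\xi)y\in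 B$ for $x,y\in B$, $\xi\in L^0_+(\mathcal F)$, $0\le\xi\le1$; $L^0$-absorbent if for every $x\in E$ there is $\xi\in L^0_{++}(\mathcal F)$ with $\eta x\in B$ for all $\eta\in L^0(\mathcal F)$, $|\eta|\le\xi$. An $L^0$-barrel is an $L^0$-balanced, $L^0$-absorbent, $L^0$-convex and closed set. A set $G$ has the countable concatenation property if for every sequence $\{x_n\}$ in $G$ and countable partition $\{A_n\}$ of $\Omega$ into sets of $\mathcal F$ there is $x\in G$ with $\tilde I_{A_n}x=\tilde I_{A_n}x_n$ for all $n$. The module is $L^0$-pre-barreled if every $L^0$-barrel with the countable concatenation property is a neighborhood of $0$. *)

theory Defs
  imports "HOL-Probability.Probability" "HOL-Algebra.Module"
begin

section \<open>Classes of measurable functions modulo almost sure equality\<close>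

definition ae_eq :: "'a measure \<Rightarrow> (('a \<Rightarrow> 'b::topological_space) \<times> ('a \<Rightarrow> 'b)) set" where
  "ae_eq N = {(f, g). f \<in> borel_measurable N \<and> g \<in> borel_measurable N \<and> (AE w in N. f w = g w)}"

definition ae_class :: "'a measure \<Rightarrow> ('a \<Rightarrow> 'b::topological_space) \<Rightarrow> ('a \<Rightarrow> 'b) set" where
  "ae_class N f = ae_eq N `` {f}"

definition L0_set :: "'a measure \<Rightarrow> ('a \<Rightarrow> 'b::topological_space) set set" where
  "L0_set N = borel_measurable N // ae_eq N"

text \<open>An arbitrary representative of a class. It is only used below in ways that do not depend on
  the choice, up to almost sure equality.\<close>

definition rep :: "('a \<Rightarrow> 'b) set \<Rightarrow> 'a \<Rightarrow> 'b" where
  "rep X = (SOME f. f \<in> X)"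

definition ae_le :: "'a measure \<Rightarrow> ('a \<Rightarrow> 'b::{topological_space, order}) set \<Rightarrow> ('a \<Rightarrow> 'b) set \<Rightarrow> bool" where
  "ae_le N X Y \<longleftrightarrow> (AE w in N. rep X w \<le> rep Y w)"

lemma equiv_ae_eq:
  fixes N :: "'a measure"
  shows "equiv (borel_measurable N) (ae_eq N :: (('a \<Rightarrow> 'b::topological_space) \<times> ('a \<Rightarrow> 'b)) set)"
proof (rule equivI)
  show "ae_eq N \<subseteq> borel_measurable N \<times> (borel_measurable N :: ('a \<Rightarrow> 'b) set)"
    unfolding ae_eq_def by blast
  show "refl_on (borel_measurable N) (ae_eq N :: (('a \<Rightarrow> 'b) \<times> ('a \<Rightarrow> 'b)) set)"
    by (rule refl_onI) (simp add: ae_eq_def)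
  show "sym (ae_eq N :: (('a \<Rightarrow> 'b) \<times> ('a \<Rightarrow> 'b)) set)"
  proof (rule symI)
    fix f g :: "'a \<Rightarrow> 'b" assume fg: "(f, g) \<in> ae_eq N"
    then have "AE w in N. f w = g w" unfolding ae_eq_def by blast
    then have "AE w in N. g w = f w" by eventually_elim (rule sym)
    then show "(g, f) \<in> ae_eq N" using fg unfolding ae_eq_def by blast
  qed
  show "trans (ae_eq N :: (('a \<Rightarrow> 'b) \<times> ('a \<Rightarrow> 'b)) set)"
  proof (rule transI)
    fix f g h :: "'a \<Rightarrow> 'b" assume fg: "(f, g) \<in> ae_eq N" and gh: "(g, h) \<in> ae_eq N"
    then have "AE w in N. f w = g w" "AE w in N. g w = h w" unfolding ae_eq_def by blast+
    then have "AE w in N. f w = h w" by eventually_elim (rule trans)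
    then show "(f, h) \<in> ae_eq N" using fg gh unfolding ae_eq_def by blast
  qed
qed

lemma ae_class_in_L0 [simp]: "f \<in> borel_measurable N \<Longrightarrow> ae_class N f \<in> L0_set N"
  by (simp add: ae_class_def L0_set_def quotientI)

lemma rep_in_class:
  assumes "X \<in> L0_set N" shows "rep X \<in> X"
  using in_quotient_imp_non_empty[OF equiv_ae_eq assms[unfolded L0_set_def]]
  by (metis all_not_in_conv rep_def someI)

lemma rep_measurable [simp]:
  assumes "X \<in> L0_set N" shows "rep X \<in> borel_measurable N"
  using in_quotient_imp_subset[OF equiv_ae_eq assms[unfolded L0_set_def]] rep_in_class[OF assms]
  by blast

lemma rep_ae_class:
  assumes "f \<in> borel_measurable N"
  shows "AE w in N. rep (ae_class N f) w = f w"
proof -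
  have "rep (ae_class N f) \<in> ae_class N f"
    using assms by (intro rep_in_class[of _ N]) simp
  then have "AE w in N. f w = rep (ae_class N f) w"
    unfolding ae_class_def ae_eq_def by blast
  then show ?thesis
    by eventually_elim simp
qed

lemma ae_class_eqI:
  assumes "f \<in> borel_measurable N" "g \<in> borel_measurable N" "AE w in N. f w = g w"
  shows "ae_class N f = ae_class N g"
  unfolding ae_class_def using assms by (intro equiv_class_eq[OF equiv_ae_eq]) (simp add: ae_eq_def)

lemma ae_class_rep:
  assumes "X \<in> L0_set N" shows "ae_class N (rep X) = X"
  using assms rep_in_class[OF assms] equiv_ae_eq[of N] unfolding ae_class_def L0_set_def
  by (metis Image_singleton_iff equiv_class_eq quotientE)


section \<open>The ring of real classes and its order\<close>

definition L0 :: "'a measure \<Rightarrow> ('a \<Rightarrow> real) set ring" where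
  "L0 N = \<lparr>carrier = L0_set N,
     monoid.mult = (\<lambda>X Y. ae_class N (\<lambda>w. rep X w * rep Y w)),
     one = ae_class N (\<lambda>_. 1),
     zero = ae_class N (\<lambda>_. 0),
     add = (\<lambda>X Y. ae_class N (\<lambda>w. rep X w + rep Y w))\<rparr>"

definition L0_abs :: "'a measure \<Rightarrow> ('a \<Rightarrow> real) set \<Rightarrow> ('a \<Rightarrow> real) set" where
  "L0_abs N X = ae_class N (\<lambda>w. \<bar>rep X w\<bar>)"

definition L0_nonneg :: "'a measure \<Rightarrow> ('a \<Rightarrow> real) set set" where
  "L0_nonneg N = {X \<in> carrier (L0 N). AE w in N. 0 \<le> rep X w}"

definition L0_pos :: "'a measure \<Rightarrow> ('a \<Rightarrow> real) set set" where
  "L0_pos N = {X \<in> carrier (L0 N). AE w in N. 0 < rep X w}"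

definition L0_ind :: "'a measure \<Rightarrow> 'a set \<Rightarrow> ('a \<Rightarrow> real) set" where
  "L0_ind N A = ae_class N (indicator A)"

text \<open>The embedding of nonnegative real classes into the classes of \<open>[0, \<infinity>]\<close>-valued functions.\<close>

definition L0_ennreal :: "'a measure \<Rightarrow> ('a \<Rightarrow> real) set \<Rightarrow> ('a \<Rightarrow> ennreal) set" where
  "L0_ennreal N X = ae_class N (\<lambda>w. ennreal (rep X w))"

definition L0_bar :: "'a measure \<Rightarrow> ('a \<Rightarrow> ennreal) set gorder" where
  "L0_bar N = \<lparr>carrier = L0_set N, eq = (=), le = ae_le N\<rparr>"

lemma L0_cases:
  assumes "X \<in> carrier (L0 N)"
  obtains f where "f \<in> borel_measurable N" "X = ae_class N f"
proof
  have "X \<in> L0_set N" using assms by (simp add: L0_def)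
  then show "rep X \<in> borel_measurable N" "X = ae_class N (rep X)"
    by (simp_all add: ae_class_rep)
qed

lemma ae_class_carrier [simp]: "f \<in> borel_measurable N \<Longrightarrow> ae_class N f \<in> carrier (L0 N)"
  by (simp add: L0_def)

lemma L0_zero: "\<zero>\<^bsub>L0 N\<^esub> = ae_class N (\<lambda>_. 0)" and L0_one: "\<one>\<^bsub>L0 N\<^esub> = ae_class N (\<lambda>_. 1)"
  by (simp_all add: L0_def)

lemma L0_add:
  assumes [measurable]: "f \<in> borel_measurable N" "g \<in> borel_measurable N"
  shows "ae_class N f \<oplus>\<^bsub>L0 N\<^esub> ae_class N g = ae_class N (\<lambda>w. f w + g w)"
proof -
  have "AE w in N. rep (ae_class N f) w + rep (ae_class N g) w = f w + g w"
    using rep_ae_class[OF assms(1)] rep_ae_class[OF assms(2)] by eventually_elim simp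
  moreover have [measurable]: "rep (ae_class N f) \<in> borel_measurable N" "rep (ae_class N g) \<in> borel_measurable N"
    by (simp_all add: assms)
  ultimately have "ae_class N (\<lambda>w. rep (ae_class N f) w + rep (ae_class N g) w) = ae_class N (\<lambda>w. f w + g w)"
    by (intro ae_class_eqI) measurable
  then show ?thesis by (simp add: L0_def)
qed

lemma L0_mult:
  assumes [measurable]: "f \<in> borel_measurable N" "g \<in> borel_measurable N"
  shows "ae_class N f \<otimes>\<^bsub>L0 N\<^esub> ae_class N g = ae_class N (\<lambda>w. f w * g w)"
proof -
  have "AE w in N. rep (ae_class N f) w * rep (ae_class N g) w = f w * g w"
    using rep_ae_class[OF assms(1)] rep_ae_class[OF assms(2)] by eventually_elim simp
  moreover have [measurable]: "rep (ae_class N f) \<in> borel_measurable N" "rep (ae_class N g) \<in> borel_measurable N"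
    by (simp_all add: assms)
  ultimately have "ae_class N (\<lambda>w. rep (ae_class N f) w * rep (ae_class N g) w) = ae_class N (\<lambda>w. f w * g w)"
    by (intro ae_class_eqI) measurable
  then show ?thesis by (simp add: L0_def)
qed

lemma cring_L0: "cring (L0 N)"
proof (rule cringI)
  show "abelian_group (L0 N)"
  proof (rule abelian_groupI)
    fix X assume "X \<in> carrier (L0 N)"
    then obtain f where f: "f \<in> borel_measurable N" "X = ae_class N f" by (rule L0_cases)
    have m: "(\<lambda>w. - f w) \<in> borel_measurable N" using f by simp
    then have "ae_class N (\<lambda>w. - f w) \<oplus>\<^bsub>L0 N\<^esub> X = \<zero>\<^bsub>L0 N\<^esub>"
      unfolding f(2) L0_add[OF m f(1)] L0_zero by simp
    then show "\<exists>Y\<in>carrier (L0 N). Y \<oplus>\<^bsub>L0 N\<^esub> X = \<zero>\<^bsub>L0 N\<^esub>"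
      using ae_class_carrier[OF m] by blast
  qed (auto elim!: L0_cases simp: L0_add L0_zero ac_simps)
  show "comm_monoid (L0 N)"
    by (rule comm_monoidI) (auto elim!: L0_cases simp: L0_mult L0_one ac_simps)
qed (auto elim!: L0_cases simp: L0_add L0_mult distrib_right)


section \<open>Notions for a module over \<open>L0 N\<close>\<close>

definition L0_balanced :: "'a measure \<Rightarrow> (('a \<Rightarrow> real) set, 'm) module \<Rightarrow> 'm set \<Rightarrow> bool" where
  "L0_balanced N E B \<longleftrightarrow> B \<subseteq> carrier E \<and>
     (\<forall>\<eta>\<in>carrier (L0 N). ae_le N (L0_abs N \<eta>) \<one>\<^bsub>L0 N\<^esub> \<longrightarrow> (\<forall>x\<in>B. \<eta> \<odot>\<^bsub>E\<^esub> x \<in> B))"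

definition L0_convex :: "'a measure \<Rightarrow> (('a \<Rightarrow> real) set, 'm) module \<Rightarrow> 'm set \<Rightarrow> bool" where
  "L0_convex N E B \<longleftrightarrow> B \<subseteq> carrier E \<and>
     (\<forall>x\<in>B. \<forall>y\<in>B. \<forall>\<xi>\<in>L0_nonneg N. ae_le N \<xi> \<one>\<^bsub>L0 N\<^esub> \<longrightarrow>
        \<xi> \<odot>\<^bsub>E\<^esub> x \<oplus>\<^bsub>E\<^esub> (\<one>\<^bsub>L0 N\<^esub> \<ominus>\<^bsub>L0 N\<^esub> \<xi>) \<odot>\<^bsub>E\<^esub> y \<in> B)"

definition L0_absorbent :: "'a measure \<Rightarrow> (('a \<Rightarrow> real) set, 'm) module \<Rightarrow> 'm set \<Rightarrow> bool" where
  "L0_absorbent N E B \<longleftrightarrow> B \<subseteq> carrier E \<and>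
     (\<forall>x\<in>carrier E. \<exists>\<xi>\<in>L0_pos N. \<forall>\<eta>\<in>carrier (L0 N).
        ae_le N (L0_abs N \<eta>) \<xi> \<longrightarrow> \<eta> \<odot>\<^bsub>E\<^esub> x \<in> B)"

definition L0_barrel :: "'a measure \<Rightarrow> (('a \<Rightarrow> real) set, 'm) module \<Rightarrow> 'm topology \<Rightarrow> 'm set \<Rightarrow> bool" where
  "L0_barrel N E T B \<longleftrightarrow>
     L0_balanced N E B \<and> L0_absorbent N E B \<and> L0_convex N E B \<and> closedin T B"

text \<open>Countable partitions are indexed by \<^typ>\<open>nat\<close>; empty pieces are allowed, so that finite
  partitions are covered.\<close>

definition countable_concatenation :: "'a measure \<Rightarrow> (('a \<Rightarrow> real) set, 'm) module \<Rightarrow> 'm set \<Rightarrow> bool" where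
  "countable_concatenation N E G \<longleftrightarrow>
     (\<forall>x :: nat \<Rightarrow> 'm. \<forall>A :: nat \<Rightarrow> 'a set.
        range x \<subseteq> G \<and> range A \<subseteq> sets N \<and> disjoint_family A \<and> (\<Union>n. A n) = space N \<longrightarrow>
        (\<exists>y\<in>G. \<forall>n. L0_ind N (A n) \<odot>\<^bsub>E\<^esub> y = L0_ind N (A n) \<odot>\<^bsub>E\<^esub> x n))"

definition L0_pre_barreled :: "'a measure \<Rightarrow> (('a \<Rightarrow> real) set, 'm) module \<Rightarrow> 'm topology \<Rightarrow> bool" where
  "L0_pre_barreled N E T \<longleftrightarrow>
     (\<forall>B. L0_barrel N E T B \<and> countable_concatenation N E B \<longrightarrow>
        (\<exists>U. openin T U \<and> \<zero>\<^bsub>E\<^esub> \<in> U \<and> U \<subseteq> B))"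

text \<open>The translation invariant topology in which the sets \<open>{u. nrm u \<le> \<epsilon>}\<close>, with \<open>\<epsilon>\<close> strictly
  positive, form a local base at zero.\<close>

definition L0_norm_topology ::
    "'a measure \<Rightarrow> (('a \<Rightarrow> real) set, 'm) module \<Rightarrow> ('m \<Rightarrow> ('a \<Rightarrow> ennreal) set) \<Rightarrow> 'm topology" where
  "L0_norm_topology N E nrm = topology (\<lambda>U. U \<subseteq> carrier E \<and>
     (\<forall>x\<in>U. \<exists>\<epsilon>\<in>L0_pos N. \<forall>u\<in>carrier E. ae_le N (nrm u) (L0_ennreal N \<epsilon>) \<longrightarrow> x \<oplus>\<^bsub>E\<^esub> u \<in> U))"

lemma L0_pos_min:
  assumes "\<delta> \<in> L0_pos N" "\<epsilon> \<in> L0_pos N"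
  shows "\<exists>\<gamma>\<in>L0_pos N. \<forall>X. ae_le N X (L0_ennreal N \<gamma>) \<longrightarrow>
    ae_le N X (L0_ennreal N \<delta>) \<and> ae_le N X (L0_ennreal N \<epsilon>)"
proof (intro bexI allI impI)
  let ?m = "\<lambda>w. min (rep \<delta> w) (rep \<epsilon> w)"
  let ?\<gamma> = "ae_class N ?m"
  have m: "rep \<delta> \<in> borel_measurable N" "rep \<epsilon> \<in> borel_measurable N"
    using assms by (auto simp: L0_pos_def L0_def)
  then have mm: "?m \<in> borel_measurable N" by simp
  have "AE w in N. 0 < rep \<delta> w" "AE w in N. 0 < rep \<epsilon> w"
    using assms by (auto simp: L0_pos_def)
  with rep_ae_class[OF mm] have "AE w in N. 0 < rep ?\<gamma> w"
    by eventually_elim simp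
  then show "?\<gamma> \<in> L0_pos N"
    using mm by (simp add: L0_pos_def L0_def)
  have g: "rep ?\<gamma> \<in> borel_measurable N" using mm by simp
  have e: "(\<lambda>w. ennreal (rep ?\<gamma> w)) \<in> borel_measurable N" "(\<lambda>w. ennreal (rep \<delta> w)) \<in> borel_measurable N"
      "(\<lambda>w. ennreal (rep \<epsilon> w)) \<in> borel_measurable N"
    using m g by (auto intro: measurable_compose[OF _ measurable_ennreal] simp del: rep_measurable ae_class_in_L0)
  have le: "AE w in N. rep (L0_ennreal N ?\<gamma>) w \<le> rep (L0_ennreal N \<delta>) w \<and>
      rep (L0_ennreal N ?\<gamma>) w \<le> rep (L0_ennreal N \<epsilon>) w"
    unfolding L0_ennreal_def
    using rep_ae_class[OF mm] rep_ae_class[OF e(1)] rep_ae_class[OF e(2)] rep_ae_class[OF e(3)]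
    by eventually_elim (simp add: ennreal_leI)
  show "ae_le N X (L0_ennreal N \<delta>) \<and> ae_le N X (L0_ennreal N \<epsilon>)"
    if "ae_le N X (L0_ennreal N ?\<gamma>)" for X
  proof -
    have "AE w in N. rep X w \<le> rep (L0_ennreal N \<delta>) w \<and> rep X w \<le> rep (L0_ennreal N \<epsilon>) w"
      using that[unfolded ae_le_def] le by eventually_elim (meson order_trans)
    then show ?thesis by (simp add: ae_le_def)
  qed
qed

lemma openin_L0_norm_topology:
  "openin (L0_norm_topology N E nrm) U \<longleftrightarrow> U \<subseteq> carrier E \<and>
     (\<forall>x\<in>U. \<exists>\<epsilon>\<in>L0_pos N. \<forall>u\<in>carrier E. ae_le N (nrm u) (L0_ennreal N \<epsilon>) \<longrightarrow> x \<oplus>\<^bsub>E\<^esub> u \<in> U)"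
proof -
  define good where "good x \<epsilon> U \<longleftrightarrow>
     (\<forall>u\<in>carrier E. ae_le N (nrm u) (L0_ennreal N \<epsilon>) \<longrightarrow> x \<oplus>\<^bsub>E\<^esub> u \<in> U)" for x \<epsilon> U
  define P where "P U \<longleftrightarrow> U \<subseteq> carrier E \<and> (\<forall>x\<in>U. \<exists>\<epsilon>\<in>L0_pos N. good x \<epsilon> U)" for U
  have good_mono: "good x \<epsilon> V" if "good x \<epsilon> U" "U \<subseteq> V" for x \<epsilon> U V
    using that unfolding good_def by blast
  have Int: "P (S \<inter> T)" if S: "P S" and T: "P T" for S T
  proof -
    have "\<exists>\<gamma>\<in>L0_pos N. good x \<gamma> (S \<inter> T)" if x: "x \<in> S \<inter> T" for x
    proof -
      obtain \<delta> \<epsilon> where pos: "\<delta> \<in> L0_pos N" "\<epsilon> \<in> L0_pos N" and good: "good x \<delta> S" "good x \<epsilon> T"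
        using S T x unfolding P_def by blast
      from L0_pos_min[OF pos] show ?thesis
      proof (rule bexE)
        fix \<gamma>
        assume \<gamma>: "\<gamma> \<in> L0_pos N"
          "\<forall>X. ae_le N X (L0_ennreal N \<gamma>) \<longrightarrow> ae_le N X (L0_ennreal N \<delta>) \<and> ae_le N X (L0_ennreal N \<epsilon>)"
        have "good x \<gamma> (S \<inter> T)"
          unfolding good_def
        proof (intro ballI impI IntI)
          fix u assume u: "u \<in> carrier E" "ae_le N (nrm u) (L0_ennreal N \<gamma>)"
          show "x \<oplus>\<^bsub>E\<^esub> u \<in> S" using good(1) u(1) \<gamma>(2)[rule_format, OF u(2)] unfolding good_def by simp
          show "x \<oplus>\<^bsub>E\<^esub> u \<in> T" using good(2) u(1) \<gamma>(2)[rule_format, OF u(2)] unfolding good_def by simp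
        qed
        then show ?thesis using \<gamma>(1) by (rule bexI)
      qed
    qed
    then show ?thesis using S unfolding P_def by blast
  qed
  have Union: "P (\<Union>K)" if K: "\<forall>S\<in>K. P S" for K
  proof -
    have "\<exists>\<epsilon>\<in>L0_pos N. good x \<epsilon> (\<Union>K)" if xS: "x \<in> S" and SK: "S \<in> K" for x S
    proof -
      have "P S" using K SK by (rule bspec)
      then have "\<forall>x\<in>S. \<exists>\<epsilon>\<in>L0_pos N. good x \<epsilon> S" unfolding P_def by (rule conjunct2)
      then have "\<exists>\<epsilon>\<in>L0_pos N. good x \<epsilon> S" using xS by (rule bspec)
      then show ?thesis
      proof (rule bexE)
        fix \<epsilon> assume e: "\<epsilon> \<in> L0_pos N" "good x \<epsilon> S"
        have "good x \<epsilon> (\<Union>K)" using e(2) Union_upper[OF SK] by (rule good_mono)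
        then show ?thesis using e(1) by (rule bexI)
      qed
    qed
    moreover have "\<Union>K \<subseteq> carrier E"
    proof (rule Union_least)
      fix S assume "S \<in> K"
      with K have "P S" by (rule bspec)
      then show "S \<subseteq> carrier E" unfolding P_def by (rule conjunct1)
    qed
    ultimately show ?thesis unfolding P_def by (metis UnionE)
  qed
  have "istopology P"
    unfolding istopology_def
  proof (intro conjI allI impI)
    show "P (S \<inter> T)" if "P S" "P T" for S T using that by (rule Int)
    show "P (\<Union>K)" if "\<forall>S\<in>K. P S" for K using that by (rule Union)
  qed
  moreover have "L0_norm_topology N E nrm = topology P"
    unfolding L0_norm_topology_def P_def good_def by (rule refl)
  ultimately have "openin (L0_norm_topology N E nrm) U \<longleftrightarrow> P U"
    by (simp only: topology_inverse')
  then show ?thesis unfolding P_def good_def .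
qed


section \<open>The modules \<open>L\<^sup>p\<close> relative to a subalgebra\<close>

text \<open>Powers with a positive real exponent on \<open>[0, \<infinity>]\<close>.\<close>

definition ennreal_powr :: "ennreal \<Rightarrow> real \<Rightarrow> ennreal" where
  "ennreal_powr a r = (if a = \<top> then \<top> else ennreal (enn2real a powr r))"

text \<open>\<open>L0 M\<close> as a module over \<open>L0 (restr_to_subalg M F)\<close>, for every subalgebra \<open>F\<close>. The fields \<^const>\<open>monoid.mult\<close> and
  \<^const>\<open>one\<close> play no role in a module; here they are inherited from the ring \<open>L0 M\<close>.\<close>

definition L0_module :: "'a measure \<Rightarrow> (('a \<Rightarrow> real) set, ('a \<Rightarrow> real) set) module" where
  "L0_module M = ring.extend (L0 M)
     (module.fields (\<lambda>\<xi> x. ae_class M (\<lambda>w. rep \<xi> w * rep x w)))"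

lemma L0_module_simps [simp]:
  "carrier (L0_module M) = carrier (L0 M)" "\<zero>\<^bsub>L0_module M\<^esub> = \<zero>\<^bsub>L0 M\<^esub>" "add (L0_module M) = add (L0 M)"
  by (simp_all add: L0_module_def ring.defs module.defs)

lemma L0_module_smult:
  assumes sub: "subalgebra M F"
    and f: "f \<in> borel_measurable (restr_to_subalg M F)" and g: "g \<in> borel_measurable M"
  shows "ae_class (restr_to_subalg M F) f \<odot>\<^bsub>L0_module M\<^esub> ae_class M g = ae_class M (\<lambda>w. f w * g w)"
proof -
  let ?N = "restr_to_subalg M F"
  have from_N: "h \<in> borel_measurable M" if "h \<in> borel_measurable ?N" for h :: "'a \<Rightarrow> real"
    using measurable_from_subalg[OF sub measurable_in_subalg'[OF sub that]] .
  have [measurable]: "f \<in> borel_measurable M" "rep (ae_class ?N f) \<in> borel_measurable M"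
    "rep (ae_class M g) \<in> borel_measurable M" "g \<in> borel_measurable M"
    using f g by (simp_all add: from_N)
  have "AE w in M. rep (ae_class ?N f) w * rep (ae_class M g) w = f w * g w"
    using AE_restr_to_subalg[OF sub rep_ae_class[OF f]] rep_ae_class[OF g] by eventually_elim simp
  then have "ae_class M (\<lambda>w. rep (ae_class ?N f) w * rep (ae_class M g) w) = ae_class M (\<lambda>w. f w * g w)"
    by (intro ae_class_eqI) measurable
  then show ?thesis by (simp add: L0_module_def ring.defs module.defs)
qed

lemma module_L0_module:
  assumes sub: "subalgebra M F"
  shows "module (L0 (restr_to_subalg M F)) (L0_module M)"
proof (rule moduleI)
  let ?N = "restr_to_subalg M F"
  have from_N: "h \<in> borel_measurable M" if "h \<in> borel_measurable ?N" for h :: "'a \<Rightarrow> real"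
    using measurable_from_subalg[OF sub measurable_in_subalg'[OF sub that]] .
  interpret R: cring "L0 M" by (rule cring_L0)
  show "cring (L0 ?N)" by (rule cring_L0)
  show "abelian_group (L0_module M)"
  proof (rule abelian_groupI)
    show "\<exists>y\<in>carrier (L0_module M). y \<oplus>\<^bsub>L0_module M\<^esub> x = \<zero>\<^bsub>L0_module M\<^esub>"
      if "x \<in> carrier (L0_module M)" for x
      using that R.l_neg[of x] R.a_inv_closed[of x] by auto
  qed (use R.a_assoc R.a_comm in auto)
  fix a b x y
  assume "a \<in> carrier (L0 ?N)" "x \<in> carrier (L0_module M)"
  then obtain f g where f: "f \<in> borel_measurable ?N" "a = ae_class ?N f"
    and g: "g \<in> borel_measurable M" "x = ae_class M g"
    by (auto elim!: L0_cases)
  have [measurable]: "f \<in> borel_measurable ?N" "f \<in> borel_measurable M" "g \<in> borel_measurable M"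
    using f g by (simp_all add: from_N)
  have fg: "(\<lambda>w. f w * g w) \<in> borel_measurable M" by measurable
  show "a \<odot>\<^bsub>L0_module M\<^esub> x \<in> carrier (L0_module M)"
    unfolding f(2) g(2) L0_module_smult[OF sub f(1) g(1)] using fg by simp
  { assume "b \<in> carrier (L0 ?N)"
    then obtain h where h: "h \<in> borel_measurable ?N" "b = ae_class ?N h" by (rule L0_cases)
    have [measurable]: "h \<in> borel_measurable ?N" "h \<in> borel_measurable M"
      using h by (simp_all add: from_N)
    have m: "(\<lambda>w. f w + h w) \<in> borel_measurable ?N" "(\<lambda>w. f w * h w) \<in> borel_measurable ?N"
      "(\<lambda>w. h w * g w) \<in> borel_measurable M" by measurable
    show "(a \<oplus>\<^bsub>L0 ?N\<^esub> b) \<odot>\<^bsub>L0_module M\<^esub> x = a \<odot>\<^bsub>L0_module M\<^esub> x \<oplus>\<^bsub>L0_module M\<^esub> b \<odot>\<^bsub>L0_module M\<^esub> x"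
      unfolding f(2) g(2) h(2) L0_module_simps L0_add[OF f(1) h(1)] L0_module_smult[OF sub m(1) g(1)]
        L0_module_smult[OF sub f(1) g(1)] L0_module_smult[OF sub h(1) g(1)] L0_add[OF fg m(3)]
      by (simp only: distrib_right)
    show "(a \<otimes>\<^bsub>L0 ?N\<^esub> b) \<odot>\<^bsub>L0_module M\<^esub> x = a \<odot>\<^bsub>L0_module M\<^esub> (b \<odot>\<^bsub>L0_module M\<^esub> x)"
      unfolding f(2) g(2) h(2) L0_mult[OF f(1) h(1)] L0_module_smult[OF sub m(2) g(1)]
        L0_module_smult[OF sub h(1) g(1)] L0_module_smult[OF sub f(1) m(3)]
      by (simp only: mult.assoc) }
  { assume "y \<in> carrier (L0_module M)"
    then obtain h where h: "h \<in> borel_measurable M" "y = ae_class M h" by (auto elim!: L0_cases)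
    note [measurable] = h(1)
    have m: "(\<lambda>w. g w + h w) \<in> borel_measurable M" "(\<lambda>w. f w * h w) \<in> borel_measurable M" by measurable
    show "a \<odot>\<^bsub>L0_module M\<^esub> (x \<oplus>\<^bsub>L0_module M\<^esub> y) = a \<odot>\<^bsub>L0_module M\<^esub> x \<oplus>\<^bsub>L0_module M\<^esub> a \<odot>\<^bsub>L0_module M\<^esub> y"
      unfolding f(2) g(2) h(2) L0_module_simps L0_add[OF g(1) h(1)] L0_module_smult[OF sub f(1) m(1)]
        L0_module_smult[OF sub f(1) g(1)] L0_module_smult[OF sub f(1) h(1)] L0_add[OF fg m(2)]
      by (simp only: distrib_left) }
next
  fix x assume "x \<in> carrier (L0_module M)"
  then obtain g where "g \<in> borel_measurable M" "x = ae_class M g" by (auto elim!: L0_cases)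
  then show "\<one>\<^bsub>L0 (restr_to_subalg M F)\<^esub> \<odot>\<^bsub>L0_module M\<^esub> x = x"
    by (simp add: L0_one L0_module_smult[OF sub])
qed

text \<open>For finite \<open>p\<close> the conditional expectation is the \<open>[0, \<infinity>]\<close>-valued one. For \<open>p = \<infinity>\<close> the infimum
  is taken in the lattice of classes of \<open>[0, \<infinity>]\<close>-valued \<open>F\<close>-measurable functions.\<close>

definition Lp_norm :: "'a measure \<Rightarrow> 'a measure \<Rightarrow> ennreal \<Rightarrow> ('a \<Rightarrow> real) set \<Rightarrow> ('a \<Rightarrow> ennreal) set" where
  "Lp_norm M F p x =
     (let N = restr_to_subalg M F in
      if p = \<infinity>
      then \<Sqinter>\<^bsub>L0_bar N\<^esub> {\<xi> \<in> carrier (L0_bar N). AE w in M. ennreal \<bar>rep x w\<bar> \<le> rep \<xi> w}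
      else ae_class N (\<lambda>w. ennreal_powr
             (nn_cond_exp M F (\<lambda>v. ennreal (\<bar>rep x v\<bar> powr enn2real p)) w) (1 / enn2real p)))"

definition Lp_module ::
    "'a measure \<Rightarrow> 'a measure \<Rightarrow> ennreal \<Rightarrow> (('a \<Rightarrow> real) set, ('a \<Rightarrow> real) set) module" where
  "Lp_module M F p = (L0_module M)\<lparr>carrier := {x \<in> carrier (L0 M).
     Lp_norm M F p x \<in> L0_ennreal (restr_to_subalg M F) ` L0_nonneg (restr_to_subalg M F)}\<rparr>"

definition Lp_topology :: "'a measure \<Rightarrow> 'a measure \<Rightarrow> ennreal \<Rightarrow> ('a \<Rightarrow> real) set topology" where
  "Lp_topology M F p =
     L0_norm_topology (restr_to_subalg M F) (Lp_module M F p) (Lp_norm M F p)"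

end

theory Submission
  imports Defs
begin

text \<open>
  Only the following facts about the norm are used. Its unit ball \<open>U\<close> is invariant under
  \<open>F\<close>-measurable factors bounded by 1 and under gluing along countable \<open>F\<close>-partitions,
  closed under almost sure limits, bounded in \<open>L\<^sup>1\<close>, and \<open>(u + v) / 4\<close> lies in it with
  \<open>u\<close> and \<open>v\<close>; so the conditional Minkowski inequality is not needed.

  Let \<open>B\<close> be a barrel with the concatenation property. By exhaustion there is a largest set \<open>C \<in> F\<close>
  on which some positive multiple of \<open>U\<close> lies in \<open>B\<close>. On the complement \<open>D\<close>, gluing yields for
  every positive \<open>F\<close>-measurable \<open>e\<close> one \<open>u \<in> U\<close> such that \<open>e u\<close> restricted to any
  non-null \<open>A \<in> F\<close> inside \<open>D\<close> is not in \<open>B\<close>. If \<open>y + v\<close> and \<open>y - v\<close> both lie in \<open>n B\<close> on a set, so does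
  \<open>v\<close>; choosing signs measurably, and radii by closedness of \<open>B\<close>, one builds a Cauchy sequence
  \<open>y\<^sub>n\<close> and random balls \<open>y\<^sub>n + r\<^sub>n U\<close> which avoid \<open>n B\<close> on every non-null part of \<open>D\<close>. Its limit
  lies in all these balls and is absorbed by \<open>B\<close>, so \<open>D\<close> is null.
\<close>

section \<open>Gluing and exhaustion\<close>

text \<open>A countable partition into sets of \<open>F\<close> is encoded by the \<open>F\<close>-measurable index \<open>i\<close> of its pieces.\<close>

definition glue_closed :: "'a measure \<Rightarrow> ('a \<Rightarrow> 'b) set \<Rightarrow> bool" where
  "glue_closed F G \<longleftrightarrow> (\<forall>g i. (\<forall>k::nat. g k \<in> G) \<and> i \<in> measurable F (count_space UNIV) \<longrightarrow> (\<lambda>w. g (i w) w) \<in> G)"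

lemma glue_closedD:
  "glue_closed F G \<Longrightarrow> (\<And>k::nat. g k \<in> G) \<Longrightarrow> i \<in> measurable F (count_space UNIV) \<Longrightarrow> (\<lambda>w. g (i w) w) \<in> G"
  unfolding glue_closed_def by blast

lemma glue_closed_singleton: "glue_closed F {g}"
  unfolding glue_closed_def by auto

lemma glue_closed_image:
  fixes T :: "'a \<Rightarrow> 'b \<Rightarrow> 'c"
  assumes "glue_closed F G"
  shows "glue_closed F ((\<lambda>g w. T w (g w)) ` G)"
  unfolding glue_closed_def
proof (intro allI impI, elim conjE)
  fix f :: "nat \<Rightarrow> 'a \<Rightarrow> 'c" and i :: "'a \<Rightarrow> nat"
  assume f: "\<forall>k. f k \<in> (\<lambda>g w. T w (g w)) ` G" and i: "i \<in> measurable F (count_space UNIV)"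
  have "\<forall>k. \<exists>g. g \<in> G \<and> f k = (\<lambda>w. T w (g w))" using f by blast
  then obtain g where g: "\<And>k. g k \<in> G" "\<And>k. f k = (\<lambda>w. T w (g k w))" using choice[of "\<lambda>k g. g \<in> G \<and> f k = (\<lambda>w. T w (g w))"] by blast
  then have "(\<lambda>w. f (i w) w) = (\<lambda>w. T w (g (i w) w))" by simp
  then show "(\<lambda>w. f (i w) w) \<in> (\<lambda>g w. T w (g w)) ` G"
    using glue_closedD[of F G g i, OF assms g(1) i] by auto
qed

text \<open>A set and its witnessing function are glued along the same index, so that a witness
  travels with the set on which it works. The glued set is the union over \<open>k\<close> of the
  part of \<open>A k\<close> on which \<open>i\<close> equals \<open>k\<close>.\<close>

definition local_property :: "'a measure \<Rightarrow> ('a set \<Rightarrow> ('a \<Rightarrow> 'b) \<Rightarrow> bool) \<Rightarrow> bool" where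
  "local_property F Q \<longleftrightarrow> (\<forall>A g i. (\<forall>k::nat. A k \<in> sets F \<and> Q (A k) (g k)) \<and> i \<in> measurable F (count_space UNIV) \<longrightarrow>
     Q {w. w \<in> A (i w)} (\<lambda>w. g (i w) w))"

lemma local_propertyI:
  assumes "\<And>A g i. (\<And>k::nat. A k \<in> sets F) \<Longrightarrow> (\<And>k. Q (A k) (g k)) \<Longrightarrow> i \<in> measurable F (count_space UNIV) \<Longrightarrow>
     Q {w. w \<in> A (i w)} (\<lambda>w. g (i w) w)"
  shows "local_property F Q"
  using assms unfolding local_property_def by blast

lemma local_propertyD:
  "local_property F Q \<Longrightarrow> (\<And>k::nat. A k \<in> sets F) \<Longrightarrow> (\<And>k. Q (A k) (g k)) \<Longrightarrow> i \<in> measurable F (count_space UNIV) \<Longrightarrow>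
     Q {w. w \<in> A (i w)} (\<lambda>w. g (i w) w)"
  unfolding local_property_def by blast

text \<open>The tested \<open>u\<close> stays fixed while the pieces are glued, so a condition on
  all of \<open>U\<close> localises one \<open>u\<close> at a time. In the uses \<open>g\<close> is
  a random radius and \<open>T u w t\<close> is \<open>t * u w\<close>, possibly shifted by
  \<open>f w\<close>.\<close>

lemma local_property_ball:
  assumes "\<And>u. u \<in> U \<Longrightarrow> local_property F (\<lambda>A g. Q A (\<lambda>w. T u w (g w)))"
  shows "local_property F (\<lambda>A g. \<forall>u\<in>U. Q A (\<lambda>w. T u w (g w)))"
  using assms unfolding local_property_def by meson

lemma local_property_map:
  assumes "local_property F Q"
  shows "local_property F (\<lambda>A g. Q A (\<lambda>w. T w (g w)))"
proof (rule local_propertyI)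
  fix A g and i :: "'a \<Rightarrow> nat" assume "\<And>k::nat. A k \<in> sets F" "\<And>k. Q (A k) (\<lambda>w. T w (g k w))" "i \<in> measurable F (count_space UNIV)"
  then show "Q {w. w \<in> A (i w)} (\<lambda>w. T w (g (i w) w))"
    using local_propertyD[OF assms, of A "\<lambda>k w. T w (g k w)" i] by simp
qed

text \<open>Representatives of the strictly positive classes, taken positive at every point so that
  division by them is valid without exceptional sets.\<close>

definition pos_functions :: "'a measure \<Rightarrow> ('a \<Rightarrow> real) set" where
  "pos_functions F = {e \<in> borel_measurable F. \<forall>w. 0 < e w}"

lemma pos_functionsD: "e \<in> pos_functions F \<Longrightarrow> e \<in> borel_measurable F" "e \<in> pos_functions F \<Longrightarrow> 0 < e w"
  by (auto simp: pos_functions_def)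

lemma glue_closed_pos_functions: "glue_closed F (pos_functions F)"
proof -
  have "(\<lambda>w. g (i w) w) \<in> borel_measurable F"
    if "\<And>k. g k \<in> borel_measurable F" "i \<in> measurable F (count_space UNIV)" for g :: "nat \<Rightarrow> 'a \<Rightarrow> real" and i
    using that by (rule measurable_compose_countable)
  then show ?thesis unfolding glue_closed_def pos_functions_def by blast
qed

lemma pos_functions_const: "0 < c \<Longrightarrow> (\<lambda>_. c) \<in> pos_functions F"
  by (simp add: pos_functions_def)

locale prob_subalgebra = prob_space M for M :: "'a measure" +
  fixes F :: "'a measure"
  assumes sub: "subalgebra M F"
begin

lemma space_F: "space F = space M" and sets_F: "A \<in> sets F \<Longrightarrow> A \<in> sets M"
  using sub by (auto simp: subalgebra_def)

lemma subset_space: "A \<in> sets F \<Longrightarrow> A \<subseteq> space M"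
  using sets.sets_into_space[of A F] by (simp add: space_F)

lemma measurable_F: "f \<in> measurable F L \<Longrightarrow> f \<in> measurable M L"
  using measurable_from_subalg[OF sub] .

text \<open>Gluing makes the sets that have a witness in \<open>G\<close> closed under countable
  unions, so the union of a sequence whose probabilities approach the supremum attains it. A further
  such set with a non-null part outside \<open>C\<close> would exceed the supremum.\<close>

lemma exhaustion:
  assumes G: "glue_closed F G" "g0 \<in> G" "Q {} g0" and Q: "local_property F Q"
  obtains C g where "C \<in> sets F" "g \<in> G" "Q C g"
    "\<And>A h. A \<in> sets F \<Longrightarrow> h \<in> G \<Longrightarrow> Q A h \<Longrightarrow> A - C \<in> null_sets M"
proof -
  define S where "S = {A \<in> sets F. \<exists>g\<in>G. Q A g}"
  have Union: "(\<Union>k. A k) \<in> S" if A: "\<And>k::nat. A k \<in> S" for A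
  proof -
    have "\<forall>k. \<exists>g. g \<in> G \<and> Q (A k) g" using A by (auto simp: S_def)
    then obtain g where g: "\<And>k. g k \<in> G" "\<And>k. Q (A k) (g k)" by metis
    have AF[measurable]: "A k \<in> sets F" for k using A by (auto simp: S_def)
    \<comment> \<open>Each point uses the first set containing it. Points outside the union get an
      unspecified index, which is harmless because no \<open>A k\<close> contains them.\<close>
    define i where "i w = (LEAST k. w \<in> A k)" for w
    have [measurable]: "i \<in> measurable F (count_space UNIV)" unfolding i_def by measurable
    have "w \<in> A (i w)" if "w \<in> A k" for w k using that unfolding i_def by (rule LeastI)
    then have "(\<Union>k. A k) = {w. w \<in> A (i w)}" by blast
    moreover have "Q {w. w \<in> A (i w)} (\<lambda>w. g (i w) w)" by (rule local_propertyD[OF Q]) (use g in auto)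
    moreover have "(\<lambda>w. g (i w) w) \<in> G" using G(1) g(1) by (rule glue_closedD) simp
    moreover have "(\<Union>k. A k) \<in> sets F" by measurable
    ultimately show ?thesis unfolding S_def by auto
  qed
  have ne: "{} \<in> S" using G by (auto simp: S_def)
  have bdd: "bdd_above (prob ` S)" by (rule bdd_aboveI[of _ 1]) auto
  define s where "s = Sup (prob ` S)"
  have le: "prob A \<le> s" if "A \<in> S" for A unfolding s_def using that bdd by (intro cSup_upper) auto
  have "\<exists>A\<in>S. s - 1 / Suc n < prob A" for n
    using less_cSup_iff[of "prob ` S" "s - 1 / Suc n"] ne bdd unfolding s_def[symmetric] by auto
  then obtain A where A: "\<And>n. A n \<in> S" "\<And>n. s - 1 / Suc n < prob (A n)" by metis
  define C where "C = (\<Union>n. A n)"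
  have C: "C \<in> S" unfolding C_def using A(1) by (rule Union)
  have SM: "A \<in> sets M" if "A \<in> S" for A using that sets_F by (auto simp: S_def)
  have "s \<le> prob C"
  proof (rule field_le_epsilon)
    fix e :: real assume "0 < e"
    then obtain n where n: "1 / Suc n < e" using nat_approx_posE by blast
    have "prob (A n) \<le> prob C" using SM[OF C] by (intro finite_measure_mono) (auto simp: C_def)
    then show "s \<le> prob C + e" using A(2)[of n] n by linarith
  qed
  moreover have "A - C \<in> null_sets M" if "A \<in> S" for A
  proof -
    \<comment> \<open>A binary union, written as a countable one so that \<open>Union\<close>
      applies.\<close>
    have "(\<Union>k::nat. (if k = 0 then C else A)) \<in> S" using C that by (intro Union) auto
    moreover have "(\<Union>k::nat. (if k = 0 then C else A)) = C \<union> (A - C)" by (auto split: if_splits)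
    ultimately have "prob (C \<union> (A - C)) \<le> s" using le by metis
    also have "\<dots> \<le> prob C" by fact
    finally have "prob (A - C) \<le> 0"
      using finite_measure_Union[of C "A - C"] SM[OF C] SM[OF that] by auto
    then show ?thesis using SM[OF C] SM[OF that] by (auto simp: null_sets_def emeasure_eq_measure intro: antisym)
  qed
  ultimately show ?thesis using C that unfolding S_def by blast
qed

end

section \<open>Barrels of functions\<close>

text \<open>\<open>U\<close> and \<open>B\<close> consist of functions instead of classes;
  \<open>B_AE\<close> makes the choice of representatives harmless. \<open>B_closed\<close> is
  closedness tested by random neighbourhoods: \<open>f\<close> belongs to \<open>B\<close> if
  \<open>f + e U\<close> meets \<open>B\<close> for every positive \<open>e\<close>.
  \<open>B_midpoint\<close> is convexity with weight 1/2. \<open>B_absorb\<close> treats the points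
  of \<open>U\<close> one at a time; the goal is to make its radius uniform.\<close>

locale module_barrel = prob_subalgebra +
  fixes U B :: "('a \<Rightarrow> real) set"
  assumes U_meas: "u \<in> U \<Longrightarrow> u \<in> borel_measurable M"
    and U_zero: "(\<lambda>_. 0) \<in> U"
    and U_scale: "u \<in> U \<Longrightarrow> h \<in> borel_measurable F \<Longrightarrow> (\<And>w. \<bar>h w\<bar> \<le> 1) \<Longrightarrow> (\<lambda>w. h w * u w) \<in> U"
    and U_glue: "glue_closed F U"
    and U_add: "u \<in> U \<Longrightarrow> v \<in> U \<Longrightarrow> (\<lambda>w. (u w + v w) / 4) \<in> U"
    and U_lim: "(\<And>n::nat. us n \<in> U) \<Longrightarrow> u \<in> borel_measurable M \<Longrightarrow> (AE w in M. (\<lambda>n. us n w) \<longlonglongrightarrow> u w) \<Longrightarrow> u \<in> U"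
    and U_int: "u \<in> U \<Longrightarrow> (\<integral>\<^sup>+w. ennreal \<bar>u w\<bar> \<partial>M) \<le> 2"
    and B_meas: "f \<in> B \<Longrightarrow> f \<in> borel_measurable M"
    and B_AE: "f \<in> B \<Longrightarrow> g \<in> borel_measurable M \<Longrightarrow> (AE w in M. f w = g w) \<Longrightarrow> g \<in> B"
    and B_scale: "f \<in> B \<Longrightarrow> h \<in> borel_measurable F \<Longrightarrow> (\<And>w. \<bar>h w\<bar> \<le> 1) \<Longrightarrow> (\<lambda>w. h w * f w) \<in> B"
    and B_midpoint: "f \<in> B \<Longrightarrow> g \<in> B \<Longrightarrow> (\<lambda>w. (f w + g w) / 2) \<in> B"
    and B_glue: "glue_closed F B"
    and B_closed: "f \<in> borel_measurable M \<Longrightarrow>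
      (\<And>e. e \<in> pos_functions F \<Longrightarrow> \<exists>u\<in>U. (\<lambda>w. f w + e w * u w) \<in> B) \<Longrightarrow> f \<in> B"
    and B_absorb: "u \<in> U \<Longrightarrow> \<exists>e\<in>pos_functions F. (\<lambda>w. e w * u w) \<in> B"
begin

section \<open>Membership in the barrel on sets of the subalgebra\<close>

definition member_on :: "'a set \<Rightarrow> ('a \<Rightarrow> real) \<Rightarrow> bool" where
  "member_on A g \<longleftrightarrow> (\<lambda>w. indicator A w * g w) \<in> B"

text \<open>The localised, hereditary negation of \<open>member_on\<close>: it excludes success on
  every non-null part, whereas failure on \<open>A\<close> as a whole would still allow it.\<close>

definition nowhere_on :: "'a set \<Rightarrow> ('a \<Rightarrow> real) \<Rightarrow> bool" where
  "nowhere_on A g \<longleftrightarrow> (\<forall>A'\<in>sets F. A' \<subseteq> A \<and> member_on A' g \<longrightarrow> A' \<in> null_sets M)"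

lemma OutD: "nowhere_on A g \<Longrightarrow> A' \<in> sets F \<Longrightarrow> A' \<subseteq> A \<Longrightarrow> member_on A' g \<Longrightarrow> A' \<in> null_sets M"
  unfolding nowhere_on_def by blast

lemma B_zero: "(\<lambda>_. 0) \<in> B"
  using B_absorb[OF U_zero] by simp

lemma member_on_empty: "member_on {} g" by (simp add: member_on_def B_zero)
lemma nowhere_on_empty: "nowhere_on {} g" by (simp add: nowhere_on_def)

lemma member_on_subset:
  assumes "member_on A g" "A' \<in> sets F" "A' \<subseteq> A" shows "member_on A' g"
proof -
  have "(\<lambda>w. indicator A' w * (indicator A w * g w)) \<in> B"
    using assms(1,2) unfolding member_on_def by (intro B_scale[where h = "indicator A'"]) (auto split: split_indicator)
  also have "(\<lambda>w. indicator A' w * (indicator A w * g w)) = (\<lambda>w. indicator A' w * g w)"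
    using assms(3) by (intro ext) (auto split: split_indicator)
  finally show ?thesis by (simp add: member_on_def)
qed

lemma member_on_null:
  assumes "member_on A g" "A \<in> sets F" "A' \<in> sets F" "A' - A \<in> null_sets M" "g \<in> borel_measurable M"
  shows "member_on A' g"
proof -
  have [measurable]: "A' \<in> sets M" "g \<in> borel_measurable M" using assms sets_F by auto
  have "member_on (A' \<inter> A) g" using assms by (intro member_on_subset[OF assms(1)]) auto
  then show ?thesis unfolding member_on_def
    by (rule B_AE) (measurable, use AE_not_in[OF assms(4)] in eventually_elim, auto split: split_indicator)
qed

lemma nowhere_on_null:
  assumes "nowhere_on A g" "A \<in> sets F" "D \<in> sets F" "D - A \<in> null_sets M"
  shows "nowhere_on D g"
  unfolding nowhere_on_def
proof (intro ballI impI, elim conjE)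
  fix A' assume A': "A' \<in> sets F" "A' \<subseteq> D" "member_on A' g"
  have "A' \<inter> A \<in> null_sets M"
    by (rule OutD[OF assms(1)]) (use A' assms in \<open>auto intro: member_on_subset\<close>)
  moreover have "A' - A \<in> null_sets M"
    by (rule null_sets_subset[OF assms(4)]) (use A' assms sets_F in auto)
  ultimately have "(A' \<inter> A) \<union> (A' - A) \<in> null_sets M" by (rule null_sets.Un)
  then show "A' \<in> null_sets M" by (simp add: Int_Diff_Un)
qed

lemma local_property_member_on: "local_property F member_on"
proof (rule local_propertyI)
  fix A g and i :: "'a \<Rightarrow> nat" assume "\<And>k::nat. member_on (A k) (g k)" "i \<in> measurable F (count_space UNIV)"
  then have "(\<lambda>w. indicator (A (i w)) w * g (i w) w) \<in> B"
    using glue_closedD[OF B_glue, of "\<lambda>k w. indicator (A k) w * g k w"] by (simp add: member_on_def)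
  then show "member_on {w. w \<in> A (i w)} (\<lambda>w. g (i w) w)" by (simp add: member_on_def indicator_def)
qed

text \<open>A part on which the glued function lies in \<open>B\<close> is cut along the index. On
  \<open>C k\<close> the glued function equals \<open>g k\<close>, so \<open>C k\<close> is null,
  and countably many such pieces make up the part.\<close>

lemma local_property_nowhere_on: "local_property F nowhere_on"
proof (rule local_propertyI, unfold nowhere_on_def, intro ballI impI, elim conjE, fold nowhere_on_def)
  fix A :: "nat \<Rightarrow> 'a set" and g and i :: "'a \<Rightarrow> nat"
  assume assms: "\<And>k. A k \<in> sets F" "\<And>k. nowhere_on (A k) (g k)" and i: "i \<in> measurable F (count_space UNIV)"
  fix A' assume A': "A' \<in> sets F" "A' \<subseteq> {w. w \<in> A (i w)}" "member_on A' (\<lambda>w. g (i w) w)"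
  define C where "C k = A' \<inter> (i -` {k} \<inter> space F)" for k
  have C: "C k \<in> sets F" for k
    unfolding C_def using A'(1) measurable_sets[OF i, of "{k}"] by auto
  have "C k \<in> null_sets M" for k
  proof (rule OutD[OF assms(2) C])
    show "C k \<subseteq> A k" using A'(2) by (auto simp: C_def)
    have "member_on (C k) (\<lambda>w. g (i w) w)" by (rule member_on_subset[OF A'(3) C]) (auto simp: C_def)
    moreover have "(\<lambda>w. indicator (C k) w * g (i w) w) = (\<lambda>w. indicator (C k) w * g k w)"
      by (auto simp: C_def split: split_indicator)
    ultimately show "member_on (C k) (g k)" by (simp add: member_on_def)
  qed
  then have "(\<Union>k. C k) \<in> null_sets M" by auto
  moreover have "(\<Union>k. C k) = A'" using sets.sets_into_space[OF A'(1)] by (auto simp: C_def)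
  ultimately show "A' \<in> null_sets M" by simp
qed

text \<open>Exhaustion over the sets on which some member of \<open>G\<close> lies in
  \<open>B\<close>. A part of the complement on which any \<open>h\<close> succeeds is disjoint from
  the maximal set \<open>C\<close>, so maximality makes it null.\<close>

lemma maximal_member_on:
  assumes "glue_closed F G" "G \<noteq> {}"
  shows "\<exists>C\<in>sets F. \<exists>g\<in>G. member_on C g \<and> (\<forall>h\<in>G. nowhere_on (space M - C) h)"
proof -
  obtain g0 where g0: "g0 \<in> G" using assms by blast
  obtain C g where C: "C \<in> sets F" "g \<in> G" "member_on C g"
    "\<And>A h. A \<in> sets F \<Longrightarrow> h \<in> G \<Longrightarrow> member_on A h \<Longrightarrow> A - C \<in> null_sets M"
    using exhaustion[OF assms(1) g0 member_on_empty local_property_member_on] by blast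
  have "nowhere_on (space M - C) h" if "h \<in> G" for h
    unfolding nowhere_on_def
  proof (intro ballI impI, elim conjE)
    fix A' assume A': "A' \<in> sets F" "A' \<subseteq> space M - C" "member_on A' h"
    then have "A' - C = A'" by auto
    then show "A' \<in> null_sets M" using C(4)[OF A'(1) that A'(3)] by simp
  qed
  then show ?thesis using C by blast
qed

text \<open>Dual exhaustion, over the sets on which some member of \<open>G\<close> escapes
  \<open>B\<close> everywhere. Each \<open>h\<close> splits the space into a set \<open>C'\<close>
  of success and a set of escape; up to a null set the latter lies in \<open>C\<close>, so
  \<open>h\<close> succeeds off \<open>C\<close>.\<close>

lemma maximal_nowhere_on:
  assumes "glue_closed F G" "G \<noteq> {}" "G \<subseteq> borel_measurable M"
  shows "\<exists>C\<in>sets F. \<exists>g\<in>G. nowhere_on C g \<and> (\<forall>h\<in>G. member_on (space M - C) h)"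
proof -
  obtain g0 where g0: "g0 \<in> G" using assms by blast
  obtain C g where C: "C \<in> sets F" "g \<in> G" "nowhere_on C g"
    "\<And>A h. A \<in> sets F \<Longrightarrow> h \<in> G \<Longrightarrow> nowhere_on A h \<Longrightarrow> A - C \<in> null_sets M"
    using exhaustion[OF assms(1) g0 nowhere_on_empty local_property_nowhere_on] by blast
  have "member_on (space M - C) h" if "h \<in> G" for h
  proof -
    obtain C' where C': "C' \<in> sets F" "member_on C' h" "nowhere_on (space M - C') h"
      using maximal_member_on[OF glue_closed_singleton, of h] by blast
    have co: "space M - A \<in> sets F" if "A \<in> sets F" for A using that sets.compl_sets[OF that] by (simp add: space_F)
    have "space M - C' - C \<in> null_sets M" by (rule C(4)[OF _ that C'(3)]) (rule co[OF C'(1)])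
    moreover have "space M - C' - C = space M - C - C'" by auto
    ultimately show ?thesis
      using assms(3) that by (intro member_on_null[OF C'(2,1) co[OF C(1)]]) auto
  qed
  then show ?thesis using C by blast
qed

section \<open>Escape from the barrel by small perturbations\<close>

text \<open>If \<open>y + v\<close> and \<open>y - v\<close> both lie in \<open>B\<close> on a set,
  then so does \<open>v\<close>, the midpoint of \<open>y + v\<close> and \<open>-(y - v)\<close>.
  Where \<open>v\<close> escapes \<open>B\<close>, the two signs therefore cannot both
  succeed.\<close>

lemma nowhere_on_add_sign:
  assumes D: "nowhere_on D v" and [measurable]: "v \<in> borel_measurable M" "y \<in> borel_measurable M"
  shows "\<exists>s\<in>borel_measurable F. (\<forall>w. \<bar>s w\<bar> = 1) \<and> nowhere_on D (\<lambda>w. y w + s w * v w)"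
proof -
  obtain C where C[measurable]: "C \<in> sets F" and member_on: "member_on C (\<lambda>w. y w + v w)" and
    nowhere_on: "nowhere_on (space M - C) (\<lambda>w. y w + v w)"
    using maximal_member_on[OF glue_closed_singleton, of "\<lambda>w. y w + v w"] by blast
  \<comment> \<open>Minus on \<open>C\<close>, where \<open>y + v\<close> lies in \<open>B\<close>,
    and plus elsewhere, where \<open>y + v\<close> escapes.\<close>
  define s :: "'a \<Rightarrow> real" where "s w = 1 - 2 * indicator C w" for w
  show ?thesis
  proof (intro bexI conjI allI)
    show "s \<in> borel_measurable F" unfolding s_def by measurable
    show "\<bar>s w\<bar> = 1" for w by (simp add: s_def split: split_indicator)
    show "nowhere_on D (\<lambda>w. y w + s w * v w)"
      unfolding nowhere_on_def
    proof (intro ballI impI, elim conjE)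
      fix A assume A: "A \<in> sets F" "A \<subseteq> D" "member_on A (\<lambda>w. y w + s w * v w)"
      have "A - C \<in> null_sets M"
      proof (rule OutD[OF nowhere_on])
        have "member_on (A - C) (\<lambda>w. y w + s w * v w)" using A C by (intro member_on_subset[OF A(3)]) auto
        moreover have "(\<lambda>w. indicator (A - C) w * (y w + s w * v w)) = (\<lambda>w. indicator (A - C) w * (y w + v w))"
          by (auto simp: s_def split: split_indicator)
        ultimately show "member_on (A - C) (\<lambda>w. y w + v w)" by (simp add: member_on_def)
        show "A - C \<in> sets F" using A(1) C by (rule sets.Diff)
        show "A - C \<subseteq> space M - C" using subset_space[OF A(1)] by blast
      qed
      moreover have "A \<inter> C \<in> null_sets M"
      proof (rule OutD[OF D])
        have "member_on (A \<inter> C) (\<lambda>w. y w + s w * v w)"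
          by (rule member_on_subset[OF A(3)]) (use A C in auto)
        moreover have "member_on (A \<inter> C) (\<lambda>w. y w + v w)"
          by (rule member_on_subset[OF member_on]) (use A C in auto)
        ultimately have "(\<lambda>w. (indicator (A \<inter> C) w * (y w + v w) +
            (-1) * (indicator (A \<inter> C) w * (y w + s w * v w))) / 2) \<in> B"
          unfolding member_on_def by (intro B_midpoint B_scale[where h = "\<lambda>_. -1"]) auto
        also have "(\<lambda>w. (indicator (A \<inter> C) w * (y w + v w) +
            (-1) * (indicator (A \<inter> C) w * (y w + s w * v w))) / 2) = (\<lambda>w. indicator (A \<inter> C) w * v w)"
          by (auto simp: s_def split: split_indicator)
        finally show "member_on (A \<inter> C) v" by (simp add: member_on_def)
        show "A \<inter> C \<in> sets F" using A(1) C by (rule sets.Int)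
        show "A \<inter> C \<subseteq> D" using A(2) by blast
      qed
      ultimately have "(A - C) \<union> (A \<inter> C) \<in> null_sets M" by (rule null_sets.Un)
      then show "A \<in> null_sets M" by (simp add: Un_Diff_Int)
    qed
  qed
qed

text \<open>Local form of the openness of the complement of \<open>B\<close>. Let \<open>H\<close>
  be the part of \<open>D\<close> left over by exhaustion over admissible radii. There every radius
  \<open>e\<close> admits some \<open>u\<close> with \<open>f + e u\<close> in \<open>B\<close>;
  closedness puts \<open>f\<close> itself in \<open>B\<close> on \<open>H\<close>, so
  \<open>H\<close> is null.\<close>

lemma nowhere_on_neighbourhood:
  assumes D[measurable]: "D \<in> sets F" and nowhere_on: "nowhere_on D f" and f[measurable]: "f \<in> borel_measurable M"
  shows "\<exists>r\<in>pos_functions F. \<forall>u\<in>U. nowhere_on D (\<lambda>w. f w + r w * u w)"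
proof -
  define Q where "Q A r \<longleftrightarrow> (\<forall>u\<in>U. nowhere_on A (\<lambda>w. f w + r w * u w))" for A r
  have Q: "local_property F Q"
    unfolding Q_def
    by (rule local_property_ball, rule local_property_map, rule local_property_nowhere_on)
  have Q0: "Q {} (\<lambda>_. 1)" by (simp add: Q_def nowhere_on_empty)
  obtain C r where C[measurable]: "C \<in> sets F" and r: "r \<in> pos_functions F" "Q C r"
    and max: "\<And>A h. A \<in> sets F \<Longrightarrow> h \<in> pos_functions F \<Longrightarrow> Q A h \<Longrightarrow> A - C \<in> null_sets M"
    using exhaustion[of _ _ Q, OF glue_closed_pos_functions pos_functions_const Q0 Q]
    by (metis zero_less_one)
  define H where "H = D - C"
  have H[measurable]: "H \<in> sets F" by (simp add: H_def)
  have HM[measurable]: "H \<in> sets M" using sets_F[OF H] .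
  have "member_on H f" unfolding member_on_def
  proof (rule B_closed)
    show "(\<lambda>w. indicator H w * f w) \<in> borel_measurable M" by measurable
    fix e assume e: "e \<in> pos_functions F"
    have em[measurable]: "e \<in> borel_measurable M" using pos_functionsD(1)[OF e] by (rule measurable_F)
    have "glue_closed F ((\<lambda>u w. f w + e w * u w) ` U)"
      using glue_closed_image[OF U_glue, of "\<lambda>w t. f w + e w * t"] by simp
    then obtain C' u where C': "C' \<in> sets F" and u: "u \<in> U" and member_on: "member_on C' (\<lambda>w. f w + e w * u w)"
      and "\<forall>h\<in>U. nowhere_on (space M - C') (\<lambda>w. f w + e w * h w)"
      using maximal_member_on[of "(\<lambda>u w. f w + e w * u w) ` U"] U_zero by blast
    \<comment> \<open>Off \<open>C'\<close> the radius \<open>e\<close> is admissible, so by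
      maximality of \<open>C\<close> almost all of \<open>H\<close> lies in
      \<open>C'\<close>.\<close>
    then have "Q (space M - C') e" by (simp add: Q_def)
    then have "space M - C' - C \<in> null_sets M"
      using max[OF _ e] sets.compl_sets[OF C'] by (simp add: space_F)
    moreover have "H - C' \<in> sets M" using HM sets_F[OF C'] by (rule sets.Diff)
    moreover have "H - C' \<subseteq> space M - C' - C" using subset_space[OF H] by (auto simp: H_def)
    ultimately have "H - C' \<in> null_sets M" by (rule null_sets_subset)
    moreover have [measurable]: "u \<in> borel_measurable M" using u by (rule U_meas)
    ultimately have "member_on H (\<lambda>w. f w + e w * u w)"
      by (intro member_on_null[OF member_on C' H]) measurable
    \<comment> \<open>Cutting off outside \<open>H\<close> leaves a perturbation of the form
      \<open>e\<close> times a member of \<open>U\<close>, as \<open>B_closed\<close>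
      demands.\<close>
    moreover have "(\<lambda>w. indicator H w * (f w + e w * u w)) =
        (\<lambda>w. indicator H w * f w + e w * (indicator H w * u w))" by (auto simp: algebra_simps)
    moreover have "(\<lambda>w. indicator H w * u w) \<in> U"
      by (intro U_scale u) (auto split: split_indicator)
    ultimately show "\<exists>u\<in>U. (\<lambda>w. indicator H w * f w + e w * u w) \<in> B" by (auto simp: member_on_def)
  qed
  then have "H \<in> null_sets M" using OutD[OF nowhere_on H] by (simp add: H_def)
  then show ?thesis using r nowhere_on_null[OF _ C D] by (auto simp: Q_def H_def)
qed

text \<open>By the dual exhaustion, all of \<open>e U\<close> lies in \<open>B\<close> off some set
  \<open>C'\<close>. Maximality puts the complement of \<open>C'\<close> inside \<open>C\<close> up
  to a null set, so the single \<open>u\<close> that escapes on \<open>C'\<close> serves on the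
  whole complement of \<open>C\<close>.\<close>

lemma maximal_imp_nowhere_on_small:
  assumes C: "C \<in> sets F" and e: "e \<in> pos_functions F"
    and max: "\<And>A. A \<in> sets F \<Longrightarrow> (\<And>u. u \<in> U \<Longrightarrow> member_on A (\<lambda>w. e w * u w)) \<Longrightarrow> A - C \<in> null_sets M"
  shows "\<exists>u\<in>U. nowhere_on (space M - C) (\<lambda>w. e w * u w)"
proof -
  have [measurable]: "e \<in> borel_measurable M" using pos_functionsD(1)[OF e] by (rule measurable_F)
  have "glue_closed F ((\<lambda>u w. e w * u w) ` U)"
    using glue_closed_image[OF U_glue, of "\<lambda>w t. e w * t"] by simp
  moreover have "(\<lambda>u w. e w * u w) ` U \<subseteq> borel_measurable M" using U_meas by auto
  ultimately obtain C' u where C': "C' \<in> sets F" and u: "u \<in> U" and nowhere_on: "nowhere_on C' (\<lambda>w. e w * u w)"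
      and member_on: "\<And>h. h \<in> U \<Longrightarrow> member_on (space M - C') (\<lambda>w. e w * h w)"
    using maximal_nowhere_on[of "(\<lambda>u w. e w * u w) ` U"] U_zero by blast
  have "space M - C' - C \<in> null_sets M"
    using max[OF _ member_on] sets.compl_sets[OF C'] by (simp add: space_F)
  moreover have "space M - C' - C = space M - C - C'" by auto
  ultimately have "nowhere_on (space M - C) (\<lambda>w. e w * u w)"
    using nowhere_on_null[OF nowhere_on C', of "space M - C"] sets.compl_sets[OF C] by (simp add: space_F)
  then show ?thesis using u by blast
qed

text \<open>One step of the ball construction. Division by \<open>c\<close> reduces avoidance of
  \<open>c B\<close> to avoidance of \<open>B\<close>: some \<open>r / (8 * c) * v\<close> escapes,
  a choice of signs carries the escape over to a perturbation of \<open>y / c\<close>, and a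
  neighbourhood of that point escapes with it.\<close>

lemma nowhere_on_perturbed:
  assumes D: "D \<in> sets F" and small: "\<And>e. e \<in> pos_functions F \<Longrightarrow> \<exists>u\<in>U. nowhere_on D (\<lambda>w. e w * u w)"
    and y[measurable]: "y \<in> borel_measurable M" and r: "r \<in> pos_functions F" and c: "0 < (c::real)"
  obtains v r' where "v \<in> U" "r' \<in> pos_functions F" "\<And>w. r' w \<le> r w / 8"
    "\<And>u. u \<in> U \<Longrightarrow> nowhere_on D (\<lambda>w. (y w + r w / 8 * v w + r' w * u w) / c)"
proof -
  have rm[measurable]: "r \<in> borel_measurable F" and rpos: "0 < r w" for w using r by (auto dest: pos_functionsD)
  have [measurable]: "r \<in> borel_measurable M" using rm by (rule measurable_F)
  have "(\<lambda>w. r w / (8 * c)) \<in> pos_functions F" using rpos c by (auto simp: pos_functions_def)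
  then obtain v where v: "v \<in> U" and Outv: "nowhere_on D (\<lambda>w. r w / (8 * c) * v w)" using small by blast
  have [measurable]: "v \<in> borel_measurable M" using v by (rule U_meas)
  obtain s where s[measurable]: "s \<in> borel_measurable F" and s1: "\<And>w. \<bar>s w\<bar> = 1"
    and Outs: "nowhere_on D (\<lambda>w. y w / c + s w * (r w / (8 * c) * v w))"
    using nowhere_on_add_sign[OF Outv, of "\<lambda>w. y w / c"] by auto
  have [measurable]: "s \<in> borel_measurable M" using s by (rule measurable_F)
  obtain q where q: "q \<in> pos_functions F"
    and Outq: "\<And>u. u \<in> U \<Longrightarrow> nowhere_on D (\<lambda>w. y w / c + s w * (r w / (8 * c) * v w) + q w * u w)"
    using nowhere_on_neighbourhood[OF D Outs] by auto
  have qm[measurable]: "q \<in> borel_measurable F" and qpos: "0 < q w" for w using q by (auto dest: pos_functionsD)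
  \<comment> \<open>The bound \<open>r / 8\<close> gives geometric decay of the radii;
    \<open>c * q\<close> is the escape radius \<open>q\<close> found after division by
    \<open>c\<close>, scaled back.\<close>
  define r' where "r' w = min (r w / 8) (c * q w)" for w
  have r'm[measurable]: "r' \<in> borel_measurable F" unfolding r'_def by measurable
  have r'pos: "0 < r' w" for w using rpos qpos c by (simp add: r'_def)
  show thesis
  proof (rule that)
    show "(\<lambda>w. s w * v w) \<in> U" using v s s1 by (intro U_scale) auto
    show "r' \<in> pos_functions F" using r'm r'pos by (simp add: pos_functions_def)
    show "r' w \<le> r w / 8" for w by (simp add: r'_def)
    fix u assume u: "u \<in> U"
    have "r' w / (c * q w) \<le> 1" for w using qpos[of w] c by (simp add: r'_def)
    moreover have "0 \<le> r' w / (c * q w)" for w using qpos[of w] c r'pos[of w] by simp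
    ultimately have "\<bar>r' w / (c * q w)\<bar> \<le> 1" for w by (simp only: abs_of_nonneg)
    with u have "(\<lambda>w. r' w / (c * q w) * u w) \<in> U" by (intro U_scale) measurable
    from Outq[OF this] have "nowhere_on D (\<lambda>w. y w / c + s w * (r w / (8 * c) * v w) + q w * (r' w / (c * q w) * u w))" .
    moreover have "y w / c + s w * (r w / (8 * c) * v w) + q w * (r' w / (c * q w) * u w) =
        (y w + r w / 8 * (s w * v w) + r' w * u w) / c" for w
      using qpos[of w] c by (simp add: field_simps)
    ultimately show "nowhere_on D (\<lambda>w. (y w + r w / 8 * (s w * v w) + r' w * u w) / c)" by simp
  qed
qed

section \<open>Random balls and their limit\<close>

text \<open>The uniform bound \<open>U_int\<close> makes the expectation of the series at most twice
  a geometric sum, so its value is finite almost surely.\<close>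

lemma AE_summable_U:
  assumes "\<And>n::nat. v n \<in> U"
  shows "AE w in M. summable (\<lambda>n. (1/8) ^ n * \<bar>v n w\<bar>)"
proof -
  have [measurable]: "v n \<in> borel_measurable M" for n using assms by (rule U_meas)
  have "(\<integral>\<^sup>+w. (\<Sum>n. ennreal ((1/8) ^ n * \<bar>v n w\<bar>)) \<partial>M) = (\<Sum>n. \<integral>\<^sup>+w. ennreal ((1/8) ^ n * \<bar>v n w\<bar>) \<partial>M)"
    by (rule nn_integral_suminf) measurable
  also have "\<dots> = (\<Sum>n. ennreal ((1/8) ^ n) * (\<integral>\<^sup>+w. ennreal \<bar>v n w\<bar> \<partial>M))"
    by (subst nn_integral_cmult[symmetric]) (auto simp: ennreal_mult)
  also have "\<dots> \<le> (\<Sum>n. ennreal ((1/8) ^ n * 2))"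
    using U_int[OF assms] by (intro suminf_le) (auto simp: ennreal_mult intro!: mult_left_mono)
  also have "\<dots> < \<top>"
    by (subst suminf_ennreal2) (auto intro!: summable_mult2 summable_geometric)
  finally have "AE w in M. (\<Sum>n. ennreal ((1/8) ^ n * \<bar>v n w\<bar>)) \<noteq> \<infinity>"
    by (intro nn_integral_PInf_AE) auto
  then show ?thesis
    by eventually_elim (rule summable_suminf_not_top, auto)
qed

text \<open>A Baire argument with the balls \<open>y n + r n U\<close>, where ball
  \<open>n + 1\<close> avoids \<open>(n + 1) B\<close> on every non-null part of \<open>D\<close>.
  The limit \<open>Y\<close> belongs to every ball, but \<open>e Y\<close> lies in \<open>B\<close>
  for some positive \<open>e\<close>, so \<open>Y\<close> lies in \<open>(n + 1) B\<close> where
  \<open>e \<ge> 1 / (n + 1)\<close>. Hence these parts of \<open>D\<close> are null, and they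
  exhaust \<open>D\<close>.\<close>

lemma null_if_nowhere_on_small:
  assumes D: "D \<in> sets F" and small: "\<And>e. e \<in> pos_functions F \<Longrightarrow> \<exists>u\<in>U. nowhere_on D (\<lambda>w. e w * u w)"
  shows "D \<in> null_sets M"
proof -
  \<comment> \<open>A state is the centre and the radius of a random ball. The start is pinned to
    centre 0 and radius 1, so that the limit will lie in \<open>U\<close> itself.\<close>
  define P where "P n = (\<lambda>(y :: 'a \<Rightarrow> real, r). y \<in> borel_measurable M \<and> r \<in> pos_functions F \<and> (n = 0 \<longrightarrow> y = (\<lambda>_. 0) \<and> r = (\<lambda>_. 1)))"
    for n :: nat
  \<comment> \<open>The ball produced from stage \<open>n\<close> avoids \<open>Suc n\<close> times
    \<open>B\<close>; this factor is positive already for \<open>n = 0\<close>.\<close>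
  define R where "R n = (\<lambda>(y, r) (y', r'). (\<forall>w. r' w \<le> r w / 8) \<and> (\<exists>v\<in>U. y' = (\<lambda>w. y w + r w / 8 * v w)) \<and>
    (\<forall>u\<in>U. nowhere_on D (\<lambda>w. (y' w + r' w * u w) / real (Suc n))))" for n
  have "\<exists>f. \<forall>n. P n (f n) \<and> R n (f n) (f (Suc n))"
  proof (rule dependent_nat_choice)
    show "\<exists>x. P 0 x" by (rule exI[of _ "((\<lambda>_. 0), (\<lambda>_. 1))"]) (simp add: P_def pos_functions_const)
    fix x n assume x: "P n x"
    obtain y r where yr: "x = (y, r)" by fastforce
    have ym[measurable]: "y \<in> borel_measurable M" and r: "r \<in> pos_functions F" using x by (auto simp: P_def yr)
    have [measurable]: "r \<in> borel_measurable M" using r by (intro measurable_F) (rule pos_functionsD)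
    obtain v r' where v: "v \<in> U" "r' \<in> pos_functions F" "\<And>w. r' w \<le> r w / 8"
      "\<And>u. u \<in> U \<Longrightarrow> nowhere_on D (\<lambda>w. (y w + r w / 8 * v w + r' w * u w) / real (Suc n))"
      using nowhere_on_perturbed[OF D small ym r, of "real (Suc n)"] by auto
    have [measurable]: "v \<in> borel_measurable M" using v(1) by (rule U_meas)
    have "P (Suc n) (\<lambda>w. y w + r w / 8 * v w, r')" using v(2) by (simp add: P_def)
    moreover have "R n x (\<lambda>w. y w + r w / 8 * v w, r')" using v by (auto simp: R_def yr)
    ultimately show "\<exists>y. P (Suc n) y \<and> R n x y" by blast
  qed
  then obtain f where f: "\<And>n. P n (f n)" "\<And>n. R n (f n) (f (Suc n))" by blast
  define y where "y n = fst (f n)" for n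
  define r where "r n = snd (f n)" for n
  have ym[measurable]: "y n \<in> borel_measurable M" and r: "r n \<in> pos_functions F" for n
    using f(1)[of n] by (auto simp: P_def y_def r_def split: prod.splits)
  have y0: "y 0 = (\<lambda>_. 0)" and r0: "r 0 = (\<lambda>_. 1)"
    using f(1)[of 0] by (auto simp: P_def y_def r_def split: prod.splits)
  have r_Suc: "r (Suc n) w \<le> r n w / 8" and v_ex: "\<exists>v\<in>U. y (Suc n) = (\<lambda>w. y n w + r n w / 8 * v w)"
    and nowhere_on: "u \<in> U \<Longrightarrow> nowhere_on D (\<lambda>w. (y (Suc n) w + r (Suc n) w * u w) / real (Suc n))" for n w u
    using f(2)[of n] by (auto simp: R_def y_def r_def split: prod.splits)
  obtain v where v: "\<And>n. v n \<in> U" and y_Suc: "\<And>n. y (Suc n) = (\<lambda>w. y n w + r n w / 8 * v n w)"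
    using v_ex by metis
  have rm[measurable]: "r n \<in> borel_measurable F" and rpos: "0 < r n w" for n w using r by (auto dest: pos_functionsD)
  have [measurable]: "r n \<in> borel_measurable M" for n using rm by (rule measurable_F)
  have r_le: "r n w \<le> (1/8) ^ n" for n w
  proof (induction n)
    case (Suc n) then show ?case using r_Suc[of n w] by simp
  qed (simp add: r0)
  \<comment> \<open>The tail from \<open>n\<close> is \<open>r n / 8 * v n\<close> plus the tail
    from \<open>n + 1\<close>. The ratio 1/8 compensates for the quarter in \<open>U_add\<close>:
    divided by \<open>r n\<close> and multiplied by 4, the first term is \<open>v n / 2\<close> and
    the second a member of \<open>U\<close> times a factor of at most 1/2.\<close>
  have tail: "(\<lambda>w. (y (n + k) w - y n w) / r n w) \<in> U" for n k
  proof (induction k arbitrary: n)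
    case 0 then show ?case by (simp add: U_zero)
  next
    case (Suc k)
    let ?u = "\<lambda>w. (y (Suc n + k) w - y (Suc n) w) / r (Suc n) w"
    have "4 * r (Suc n) w / r n w \<le> 1" for w using r_Suc[of n w] rpos[of n w] by (simp add: field_simps)
    moreover have "0 \<le> 4 * r (Suc n) w / r n w" for w using rpos[of n w] rpos[of "Suc n" w] by simp
    ultimately have "\<bar>4 * r (Suc n) w / r n w\<bar> \<le> 1" for w by (simp only: abs_of_nonneg)
    then have "(\<lambda>w. 4 * r (Suc n) w / r n w * ?u w) \<in> U" by (intro U_scale Suc) measurable
    moreover have "(\<lambda>w. (1/2) * v n w) \<in> U" by (intro U_scale v) auto
    ultimately have "(\<lambda>w. (4 * r (Suc n) w / r n w * ?u w + (1/2) * v n w) / 4) \<in> U" by (rule U_add)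
    moreover have "(4 * r (Suc n) w / r n w * ?u w + (1/2) * v n w) / 4 = (y (n + Suc k) w - y n w) / r n w" for w
      using rpos[of n w] rpos[of "Suc n" w] by (simp add: y_Suc field_simps)
    ultimately show ?case by (simp only:)
  qed
  \<comment> \<open>\<open>lim\<close> is unspecified where the sequence diverges, but
    \<open>Y\<close> is measurable there too, and that set turns out to be null.\<close>
  define Y where "Y w = lim (\<lambda>n. y n w)" for w
  have Ym[measurable]: "Y \<in> borel_measurable M" unfolding Y_def by measurable
  have lim: "AE w in M. (\<lambda>n. y n w) \<longlonglongrightarrow> Y w"
    using AE_summable_U[of v, OF v]
  proof eventually_elim
    case (elim w)
    have "summable (\<lambda>n. y (Suc n) w - y n w)"
    proof (rule summable_comparison_test'[OF elim])
      fix n :: nat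
      have "r n w / 8 \<le> (1/8) ^ n" using r_le[of n w] rpos[of n w] by simp
      then show "norm (y (Suc n) w - y n w) \<le> (1/8) ^ n * \<bar>v n w\<bar>"
        using rpos[of n w] by (simp add: y_Suc abs_mult mult_right_mono del: times_divide_eq_left)
    qed
    then have "convergent (\<lambda>n. \<Sum>k<n. y (Suc k) w - y k w)" by (simp add: summable_iff_convergent)
    moreover have "(\<Sum>k<n. y (Suc k) w - y k w) = y n w" for n
      using sum_lessThan_telescope[of "\<lambda>k. y k w" n] by (simp add: y0)
    ultimately show ?case unfolding Y_def by (simp add: convergent_LIMSEQ_iff)
  qed
  have YU: "(\<lambda>w. (Y w - y n w) / r n w) \<in> U" for n
  proof (rule U_lim[OF tail])
    show "AE w in M. (\<lambda>k. (y (n + k) w - y n w) / r n w) \<longlonglongrightarrow> (Y w - y n w) / r n w"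
      using lim
    proof eventually_elim
      case (elim w)
      have "(\<lambda>k. y (n + k) w) \<longlonglongrightarrow> Y w" using LIMSEQ_ignore_initial_segment[OF elim, of n] by (simp add: add.commute)
      then show ?case using rpos[of n w] by (intro tendsto_intros) auto
    qed
  qed measurable
  \<comment> \<open>Ball 0 is \<open>U\<close>, so \<open>B_absorb\<close> applies to
    \<open>Y\<close>.\<close>
  have "Y \<in> U" using YU[of 0] by (simp add: y0 r0)
  then obtain e where e: "e \<in> pos_functions F" and eY: "(\<lambda>w. e w * Y w) \<in> B" using B_absorb by blast
  have em[measurable]: "e \<in> borel_measurable F" and epos: "0 < e w" for w using e by (auto dest: pos_functionsD)
  \<comment> \<open>On \<open>A n\<close> the factor \<open>1 / (Suc n * e)\<close> is at most 1, so
    balancedness turns \<open>e Y\<close> in \<open>B\<close> into \<open>Y / Suc n\<close> in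
    \<open>B\<close>.\<close>
  define A where "A n = D \<inter> {w \<in> space F. 1 / real (Suc n) \<le> e w}" for n
  have A[measurable]: "A n \<in> sets F" for n unfolding A_def using D by measurable
  have "A n \<in> null_sets M" for n
  proof (rule OutD[OF nowhere_on[OF YU[of "Suc n"]] A])
    show "A n \<subseteq> D" by (simp add: A_def)
    have "(\<lambda>w. indicator (A n) w / (real (Suc n) * e w) * (e w * Y w)) \<in> B"
    proof (rule B_scale[OF eY])
      show "\<bar>indicator (A n) w / (real (Suc n) * e w)\<bar> \<le> 1" for w
        using epos[of w] by (auto simp: A_def field_simps split: split_indicator)
    qed measurable
    \<comment> \<open>\<open>Y\<close> is rewritten as a centre plus a radius times a member of
      \<open>U\<close>, the form that ball \<open>n + 1\<close> keeps out of
      \<open>B\<close>.\<close>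
    also have "(\<lambda>w. indicator (A n) w / (real (Suc n) * e w) * (e w * Y w)) =
      (\<lambda>w. indicator (A n) w * ((y (Suc n) w + r (Suc n) w * ((Y w - y (Suc n) w) / r (Suc n) w)) / real (Suc n)))"
    proof
      fix w show "indicator (A n) w / (real (Suc n) * e w) * (e w * Y w) = 
        indicator (A n) w * ((y (Suc n) w + r (Suc n) w * ((Y w - y (Suc n) w) / r (Suc n) w)) / real (Suc n))"
        using epos[of w] rpos[of "Suc n" w] by simp
    qed
    finally show "member_on (A n) (\<lambda>w. (y (Suc n) w + r (Suc n) w * ((Y w - y (Suc n) w) / r (Suc n) w)) / real (Suc n))"
      by (simp add: member_on_def)
  qed
  then have "(\<Union>n. A n) \<in> null_sets M" by auto
  moreover have "(\<Union>n. A n) = D"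
  proof
    show "D \<subseteq> (\<Union>n. A n)"
    proof
      fix w assume w: "w \<in> D"
      obtain n where "1 / real (Suc n) < e w" using nat_approx_posE[OF epos[of w]] by auto
      then have "w \<in> A n" using w subset_space[OF D] by (auto simp: A_def space_F)
      then show "w \<in> (\<Union>n. A n)" by blast
    qed
  qed (auto simp: A_def)
  ultimately show ?thesis by simp
qed

text \<open>Exhaustion over the sets on which one random radius works for all of \<open>U\<close>.
  Off the maximal set every radius is defeated by a single member of \<open>U\<close>, which forces
  the complement to be null; invariance of \<open>B\<close> under almost sure equality then removes
  it.\<close>

theorem U_absorbed:
  "\<exists>e\<in>pos_functions F. \<forall>u\<in>U. (\<lambda>w. e w * u w) \<in> B"
proof -
  define Q where "Q A e \<longleftrightarrow> (\<forall>u\<in>U. member_on A (\<lambda>w. e w * u w))" for A e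
  have Q: "local_property F Q"
    unfolding Q_def by (rule local_property_ball, rule local_property_map, rule local_property_member_on)
  have Q0: "Q {} (\<lambda>_. 1)" by (simp add: Q_def member_on_empty)
  obtain C e where C: "C \<in> sets F" and e: "e \<in> pos_functions F" and QC: "Q C e"
    and max: "\<And>A h. A \<in> sets F \<Longrightarrow> h \<in> pos_functions F \<Longrightarrow> Q A h \<Longrightarrow> A - C \<in> null_sets M"
    using exhaustion[of _ _ Q, OF glue_closed_pos_functions pos_functions_const Q0 Q]
    by (metis zero_less_one)
  have space: "space M \<in> sets F" using sets.top[of F] by (simp add: space_F)
  have null: "space M - C \<in> null_sets M"
  proof (rule null_if_nowhere_on_small)
    show "space M - C \<in> sets F" using space C by (rule sets.Diff)
    show "\<exists>u\<in>U. nowhere_on (space M - C) (\<lambda>w. h w * u w)" if "h \<in> pos_functions F" for h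
      using C that by (rule maximal_imp_nowhere_on_small) (use max that in \<open>auto simp: Q_def\<close>)
  qed
  have "(\<lambda>w. e w * u w) \<in> B" if u: "u \<in> U" for u
  proof -
    have m: "(\<lambda>w. e w * u w) \<in> borel_measurable M"
      using U_meas[OF u] measurable_F[OF pos_functionsD(1)[OF e]] by (rule borel_measurable_times[rotated])
    have "member_on C (\<lambda>w. e w * u w)" using QC u by (simp add: Q_def)
    then have "member_on (space M) (\<lambda>w. e w * u w)" by (rule member_on_null[OF _ C space null m])
    then show ?thesis unfolding member_on_def by (rule B_AE[OF _ m]) auto
  qed
  then show ?thesis using e by blast
qed

end

section \<open>The unit ball of the norm\<close>

text \<open>For finite \<open>p\<close> the inequality \<open>E(|u|\<^sup>p | F) \<le> 1\<close> is tested by integrating over the sets of \<open>F\<close>.\<close>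

definition cond_ball :: "'a measure \<Rightarrow> 'a measure \<Rightarrow> ennreal \<Rightarrow> ('a \<Rightarrow> real) set" where
  "cond_ball M F p = {u \<in> borel_measurable M.
     if p = \<infinity> then AE w in M. \<bar>u w\<bar> \<le> 1
     else \<forall>A\<in>sets F. (\<integral>\<^sup>+w\<in>A. ennreal (\<bar>u w\<bar> powr enn2real p) \<partial>M) \<le> emeasure M A}"

section \<open>Norm bounds for finite exponents, tested on the subalgebra\<close>

lemma ennreal_powr_le_iff:
  assumes "0 < e" "0 < r"
  shows "ennreal_powr a (1 / r) \<le> ennreal e \<longleftrightarrow> a \<le> ennreal (e powr r)"
proof (cases "a = \<top>")
  case True then show ?thesis by (simp add: ennreal_powr_def top_unique)
next
  case False
  then obtain t where t: "a = ennreal t" "0 \<le> t" by (metis ennreal_cases infinity_ennreal_def)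
  have "t powr (1 / r) \<le> e \<longleftrightarrow> t \<le> e powr r"
  proof
    assume "t powr (1 / r) \<le> e"
    then have "(t powr (1 / r)) powr r \<le> e powr r" using assms by (intro powr_mono2) auto
    then show "t \<le> e powr r" using assms t by (simp add: powr_powr)
  next
    assume "t \<le> e powr r"
    then have "t powr (1 / r) \<le> (e powr r) powr (1 / r)" using assms t by (intro powr_mono2) auto
    then show "t powr (1 / r) \<le> e" using assms by (simp add: powr_powr)
  qed
  then show ?thesis using t assms by (simp add: ennreal_powr_def)
qed

context prob_subalgebra
begin

text \<open>For the converse the test set is \<open>{h > 1}\<close>, which belongs to
  \<open>F\<close>: there the non-negative function \<open>h - 1\<close> has integral 0, so it
  vanishes almost surely.\<close>

lemma AE_le_1_iff:
  assumes [measurable]: "h \<in> borel_measurable F"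
  shows "(AE w in M. h w \<le> (1::ennreal)) \<longleftrightarrow> (\<forall>A\<in>sets F. (\<integral>\<^sup>+w\<in>A. h w \<partial>M) \<le> emeasure M A)"
proof
  assume le: "AE w in M. h w \<le> 1"
  show "\<forall>A\<in>sets F. (\<integral>\<^sup>+w\<in>A. h w \<partial>M) \<le> emeasure M A"
  proof
    fix A assume "A \<in> sets F"
    have "(\<integral>\<^sup>+w\<in>A. h w \<partial>M) \<le> (\<integral>\<^sup>+w. indicator A w \<partial>M)"
      by (rule nn_integral_mono_AE) (use le in eventually_elim, auto split: split_indicator)
    then show "(\<integral>\<^sup>+w\<in>A. h w \<partial>M) \<le> emeasure M A" using sets_F[OF \<open>A \<in> sets F\<close>] by simp
  qed
next
  assume le: "\<forall>A\<in>sets F. (\<integral>\<^sup>+w\<in>A. h w \<partial>M) \<le> emeasure M A"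
  have hM[measurable]: "h \<in> borel_measurable M" using assms by (rule measurable_F)
  define A where "A = {w \<in> space F. 1 < h w}"
  have A: "A \<in> sets F" unfolding A_def by measurable
  have AM[measurable]: "A \<in> sets M" using A by (rule sets_F)
  have "(\<integral>\<^sup>+w. (h w - 1) * indicator A w \<partial>M) = (\<integral>\<^sup>+w. h w * indicator A w - indicator A w \<partial>M)"
    by (intro nn_integral_cong) (auto split: split_indicator)
  also have "\<dots> = (\<integral>\<^sup>+w\<in>A. h w \<partial>M) - (\<integral>\<^sup>+w. indicator A w \<partial>M)"
  proof (rule nn_integral_diff)
    show "(\<integral>\<^sup>+w. indicator A w \<partial>M) \<noteq> \<infinity>" by (simp add: emeasure_eq_measure)
    show "AE w in M. indicator A w \<le> h w * indicator A w" by (auto simp: A_def split: split_indicator)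
  qed measurable
  also have "\<dots> = 0"
  proof (rule diff_eq_0_ennreal)
    show le: "(\<integral>\<^sup>+w\<in>A. h w \<partial>M) \<le> (\<integral>\<^sup>+w. indicator A w \<partial>M)" using le A by simp
    show "(\<integral>\<^sup>+w\<in>A. h w \<partial>M) < \<top>" by (rule le_less_trans[OF le]) (simp add: emeasure_eq_measure)
  qed
  finally have "AE w in M. (h w - 1) * indicator A w = 0" by (subst (asm) nn_integral_0_iff_AE) auto
  then show "AE w in M. h w \<le> 1"
    using AE_space
  proof eventually_elim
    case (elim w)
    then show ?case
      by (cases "h w \<le> 1") (auto simp: A_def space_F diff_eq_0_iff_ennreal split: split_indicator_asm)
  qed
qed

text \<open>The factor \<open>e powr - r\<close> is \<open>F\<close>-measurable, so under integrals
  over sets of \<open>F\<close> it moves inside the conditional expectation. With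
  \<open>AE_le_1_iff\<close> the norm bound becomes the integral test for
  \<open>x / e\<close>.\<close>

lemma cond_ball_norm_finite:
  assumes p: "1 \<le> p" "p \<noteq> \<infinity>" and x[measurable]: "x \<in> borel_measurable M" and e: "e \<in> pos_functions F"
  shows "(AE w in M. ennreal_powr (nn_cond_exp M F (\<lambda>v. ennreal (\<bar>x v\<bar> powr enn2real p)) w) (1 / enn2real p) \<le> ennreal (e w))
    \<longleftrightarrow> (\<lambda>w. x w / e w) \<in> cond_ball M F p"
proof -
  interpret finite_measure_subalgebra M F
    by unfold_locales (rule sub)
  define r where "r = enn2real p"
  have "0 < r" using p unfolding r_def by (metis enn2real_positive_iff infinity_ennreal_def less_le_trans less_top zero_less_one)
  define G where "G = nn_cond_exp M F (\<lambda>v. ennreal (\<bar>x v\<bar> powr r))"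
  have Gm[measurable]: "G \<in> borel_measurable F" unfolding G_def by measurable
  have em[measurable]: "e \<in> borel_measurable F" and epos: "0 < e w" for w using e by (auto dest: pos_functionsD)
  have [measurable]: "e \<in> borel_measurable M" using em by (rule measurable_F)
  define c where "c w = ennreal (e w powr - r)" for w
  have cm[measurable]: "c \<in> borel_measurable F" unfolding c_def by measurable
  have "ennreal_powr (G w) (1 / r) \<le> ennreal (e w) \<longleftrightarrow> c w * G w \<le> 1" for w
  proof -
    have "c w * G w \<le> 1 \<longleftrightarrow> c w * G w \<le> c w * ennreal (e w powr r)"
      using epos[of w] by (simp add: c_def ennreal_mult[symmetric] powr_add[symmetric])
    also have "\<dots> \<longleftrightarrow> G w \<le> ennreal (e w powr r)"
      using epos[of w] by (intro ennreal_mult_le_mult_iff) (auto simp: c_def)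
    finally show ?thesis using ennreal_powr_le_iff[OF epos[of w] \<open>0 < r\<close>] by simp
  qed
  then have "(AE w in M. ennreal_powr (G w) (1 / r) \<le> ennreal (e w)) \<longleftrightarrow> (AE w in M. c w * G w \<le> 1)" by simp
  also have "\<dots> \<longleftrightarrow> (\<forall>A\<in>sets F. (\<integral>\<^sup>+w\<in>A. c w * G w \<partial>M) \<le> emeasure M A)"
    by (rule AE_le_1_iff) measurable
  also have "\<dots> \<longleftrightarrow> (\<forall>A\<in>sets F. (\<integral>\<^sup>+w\<in>A. ennreal (\<bar>x w / e w\<bar> powr r) \<partial>M) \<le> emeasure M A)"
  proof (rule ball_cong[OF refl])
    fix A assume [measurable]: "A \<in> sets F"
    have "(\<integral>\<^sup>+w\<in>A. c w * G w \<partial>M) = (\<integral>\<^sup>+w. (c w * indicator A w) * G w \<partial>M)"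
      by (intro nn_integral_cong) (simp add: ac_simps)
    also have "\<dots> = (\<integral>\<^sup>+w. (c w * indicator A w) * ennreal (\<bar>x w\<bar> powr r) \<partial>M)"
      unfolding G_def by (rule nn_cond_exp_intg) measurable
    also have "\<dots> = (\<integral>\<^sup>+w\<in>A. ennreal (\<bar>x w / e w\<bar> powr r) \<partial>M)"
    proof (intro nn_integral_cong)
      fix w
      have "c w * ennreal (\<bar>x w\<bar> powr r) = ennreal (\<bar>x w / e w\<bar> powr r)"
        using epos[of w] by (simp add: c_def ennreal_mult[symmetric] powr_divide powr_minus field_simps)
      then show "(c w * indicator A w) * ennreal (\<bar>x w\<bar> powr r) = ennreal (\<bar>x w / e w\<bar> powr r) * indicator A w"
        by (simp split: split_indicator)
    qed
    finally show "((\<integral>\<^sup>+w\<in>A. c w * G w \<partial>M) \<le> emeasure M A) = ((\<integral>\<^sup>+w\<in>A. ennreal (\<bar>x w / e w\<bar> powr r) \<partial>M) \<le> emeasure M A)"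
      by simp
  qed
  also have "\<dots> \<longleftrightarrow> (\<lambda>w. x w / e w) \<in> cond_ball M F p"
    using p by (simp add: cond_ball_def r_def)
  finally show ?thesis by (simp add: G_def r_def)
qed

section \<open>Essential upper bounds and the infinity norm\<close>

text \<open>For each rational level \<open>q n\<close> exhaustion finds a largest set
  \<open>C n\<close> of \<open>F\<close> on which \<open>f \<le> q n\<close>. The infimum of the
  levels whose sets contain the point bounds \<open>f\<close>. For any other bound \<open>h\<close>
  the set where \<open>h \<le> q n\<close> lies in \<open>C n\<close> up to a null set, so the
  infimum is at most \<open>h\<close>.\<close>

lemma essential_upper_bound:
  fixes f :: "'a \<Rightarrow> ennreal"
  obtains g where "g \<in> borel_measurable F" "AE w in M. f w \<le> g w"
    "\<And>h. h \<in> borel_measurable F \<Longrightarrow> AE w in M. f w \<le> h w \<Longrightarrow> AE w in M. g w \<le> h w"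
proof -
  \<comment> \<open>\<open>ennreal\<close> sends negative rationals to 0, so the levels are exactly
    the non-negative rationals.\<close>
  define q where "q n = ennreal (real_of_rat (from_nat n))" for n
  have ex: "\<exists>C. C \<in> sets F \<and> (AE w in M. w \<in> C \<longrightarrow> f w \<le> q n) \<and>
    (\<forall>A\<in>sets F. (AE w in M. w \<in> A \<longrightarrow> f w \<le> q n) \<longrightarrow> A - C \<in> null_sets M)" for n
  proof -
    \<comment> \<open>The level enters as the function argument, so that \<open>exhaustion\<close>
      applies with a singleton of constants.\<close>
    define Q :: "'a set \<Rightarrow> ('a \<Rightarrow> ennreal) \<Rightarrow> bool" where "Q A g \<longleftrightarrow> (AE w in M. w \<in> A \<longrightarrow> f w \<le> g w)" for A g
    have Q: "local_property F Q"
    proof (rule local_propertyI)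
      fix A g and i :: "'a \<Rightarrow> nat" assume "\<And>k::nat. Q (A k) (g k)"
      then have "AE w in M. \<forall>k. w \<in> A k \<longrightarrow> f w \<le> g k w" unfolding Q_def by (subst AE_all_countable) blast
      then show "Q {w. w \<in> A (i w)} (\<lambda>w. g (i w) w)" unfolding Q_def by eventually_elim simp
    qed
    have Q0: "Q {} (\<lambda>_. q n)" by (simp add: Q_def)
    obtain C g where "C \<in> sets F" "g \<in> {\<lambda>_. q n}" "Q C g"
        "\<And>A h. A \<in> sets F \<Longrightarrow> h \<in> {\<lambda>_. q n} \<Longrightarrow> Q A h \<Longrightarrow> A - C \<in> null_sets M"
      using exhaustion[OF glue_closed_singleton[of F "\<lambda>_. q n"] singletonI Q0 Q] by blast
    then show ?thesis unfolding Q_def by auto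
  qed
  have "\<exists>C. \<forall>n. C n \<in> sets F \<and> (AE w in M. w \<in> C n \<longrightarrow> f w \<le> q n) \<and>
    (\<forall>A\<in>sets F. (AE w in M. w \<in> A \<longrightarrow> f w \<le> q n) \<longrightarrow> A - C n \<in> null_sets M)"
    by (rule choice) (rule allI, rule ex)
  then obtain C where CC: "\<forall>n. C n \<in> sets F \<and> (AE w in M. w \<in> C n \<longrightarrow> f w \<le> q n) \<and>
    (\<forall>A\<in>sets F. (AE w in M. w \<in> A \<longrightarrow> f w \<le> q n) \<longrightarrow> A - C n \<in> null_sets M)" ..
  have C[measurable]: "C n \<in> sets F" and le: "AE w in M. w \<in> C n \<longrightarrow> f w \<le> q n" for n
    using CC by simp_all
  have max: "A - C n \<in> null_sets M" if "A \<in> sets F" "AE w in M. w \<in> A \<longrightarrow> f w \<le> q n" for A n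
    using CC that by simp
  \<comment> \<open>A level whose set misses the point contributes \<open>\<top>\<close>, which is
    also the value of \<open>g\<close> off all \<open>C n\<close>.\<close>
  define g where "g w = (INF n. if w \<in> C n then q n else \<top>)" for w
  show thesis
  proof (rule that)
    show "g \<in> borel_measurable F" unfolding g_def by measurable
    have "AE w in M. \<forall>n. w \<in> C n \<longrightarrow> f w \<le> q n" using le by (simp add: AE_all_countable)
    then show "AE w in M. f w \<le> g w"
      unfolding g_def by eventually_elim (rule INF_greatest, simp)
    fix h :: "'a \<Rightarrow> ennreal"
    assume [measurable]: "h \<in> borel_measurable F" and fh: "AE w in M. f w \<le> h w"
    have "{w \<in> space F. h w \<le> q n} - C n \<in> null_sets M" for n
    proof (rule max)
      show "{w \<in> space F. h w \<le> q n} \<in> sets F" by measurable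
      show "AE w in M. w \<in> {w \<in> space F. h w \<le> q n} \<longrightarrow> f w \<le> q n"
        using fh by eventually_elim auto
    qed
    then have "AE w in M. \<forall>n. w \<notin> {w \<in> space F. h w \<le> q n} - C n"
      unfolding AE_all_countable by (intro allI AE_not_in)
    then show "AE w in M. g w \<le> h w"
      using AE_space
    proof eventually_elim
      case (elim w)
      have gq: "g w \<le> q n" if "h w \<le> q n" for n
      proof -
        have "w \<in> C n" using elim that by (auto simp: space_F)
        then show ?thesis unfolding g_def by (intro INF_lower2[of n]) auto
      qed
      show ?case
      proof (rule dense_ge)
        fix t assume "h w < t"
        \<comment> \<open>\<open>s\<close> is finite even if \<open>t\<close> is not, which leaves
          room for a rational level between \<open>h w\<close> and \<open>s\<close>.\<close>
        then obtain s where s: "h w < s" "s < t" using dense by blast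
        then have "s \<noteq> \<top>" "h w \<noteq> \<top>" by auto
        then obtain a b where a: "h w = ennreal a" "0 \<le> a" and b: "s = ennreal b" "0 \<le> b"
          by (metis ennreal_cases infinity_ennreal_def)
        have "a < b" using s(1) a b by (simp add: ennreal_less_iff)
        then obtain c where c: "a < real_of_rat c" "real_of_rat c < b" using of_rat_dense by blast
        then have "h w \<le> q (to_nat c)" "q (to_nat c) \<le> s" using a b by (auto simp: q_def intro!: ennreal_leI)
        then show "g w \<le> t" using gq[of "to_nat c"] s by auto
      qed
    qed
  qed
qed

lemma AE_N_iff: "Measurable.pred F P \<Longrightarrow> (AE w in restr_to_subalg M F. P w) \<longleftrightarrow> (AE w in M. P w)"
  using AE_restr_to_subalg[OF sub] AE_restr_to_subalg2[OF sub] by blast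

lemma measurable_N_iff: "f \<in> measurable (restr_to_subalg M F) L \<longleftrightarrow> f \<in> measurable F L"
  using measurable_in_subalg[OF sub] measurable_in_subalg'[OF sub] by blast

lemma rep_measurable_F: "X \<in> L0_set (restr_to_subalg M F) \<Longrightarrow> rep X \<in> borel_measurable F"
  using rep_measurable measurable_N_iff by blast

lemma rep_ae_class_F: "f \<in> borel_measurable F \<Longrightarrow> AE w in M. rep (ae_class (restr_to_subalg M F) f) w = f w"
  using rep_ae_class[of f "restr_to_subalg M F"] AE_restr_to_subalg[OF sub] by (simp add: measurable_N_iff)

lemma ae_le_iff:
  fixes X Y :: "('a \<Rightarrow> 'b::{second_countable_topology, linorder_topology}) set"
  assumes "X \<in> L0_set (restr_to_subalg M F)" "Y \<in> L0_set (restr_to_subalg M F)"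
  shows "ae_le (restr_to_subalg M F) X Y \<longleftrightarrow> (AE w in M. rep X w \<le> rep Y w)"
proof -
  note [measurable] = assms[THEN rep_measurable_F]
  show ?thesis unfolding ae_le_def by (rule AE_N_iff) measurable
qed

text \<open>The class of the essential upper bound is one of the competitors in the infimum and lies
  below all of them. Antisymmetry of the almost sure order on classes makes the greatest lower bound
  unique, which settles the choice operator inside the infimum.\<close>

lemma Lp_norm_infinity:
  assumes x: "x \<in> borel_measurable M"
  defines "N \<equiv> restr_to_subalg M F"
  obtains z where "z \<in> L0_set N" "Lp_norm M F \<infinity> (ae_class M x) = z"
    "AE w in M. ennreal \<bar>x w\<bar> \<le> rep z w"
    "\<And>h. h \<in> borel_measurable F \<Longrightarrow> AE w in M. ennreal \<bar>x w\<bar> \<le> h w \<Longrightarrow> AE w in M. rep z w \<le> h w"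
proof -
  let ?f = "\<lambda>w. ennreal \<bar>x w\<bar>"
  have rx: "AE w in M. rep (ae_class M x) w = x w" using x by (rule rep_ae_class)
  obtain g where g: "g \<in> borel_measurable F" "AE w in M. ?f w \<le> g w"
    and least: "\<And>h. h \<in> borel_measurable F \<Longrightarrow> AE w in M. ?f w \<le> h w \<Longrightarrow> AE w in M. g w \<le> h w"
    using essential_upper_bound[of ?f] by blast
  define z where "z = ae_class N g"
  have gN: "g \<in> borel_measurable N" using g(1) by (simp add: N_def measurable_N_iff)
  have z: "z \<in> L0_set N" unfolding z_def using gN by simp
  have rz: "AE w in M. rep z w = g w" unfolding z_def N_def using g(1) by (rule rep_ae_class_F)
  have zx: "AE w in M. ?f w \<le> rep z w" using rz g(2) by eventually_elim simp
  have zleast: "AE w in M. rep z w \<le> h w" if "h \<in> borel_measurable F" "AE w in M. ?f w \<le> h w" for h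
    using rz least[OF that] by eventually_elim simp
  define S where "S = {\<xi> \<in> carrier (L0_bar N). AE w in M. ennreal \<bar>rep (ae_class M x) w\<bar> \<le> rep \<xi> w}"
  have S: "\<xi> \<in> S \<longleftrightarrow> \<xi> \<in> L0_set N \<and> (AE w in M. ?f w \<le> rep \<xi> w)" for \<xi>
  proof -
    have "(AE w in M. ennreal \<bar>rep (ae_class M x) w\<bar> \<le> rep \<xi> w) \<longleftrightarrow> (AE w in M. ?f w \<le> rep \<xi> w)"
      by (rule eventually_subst, use rx in eventually_elim, simp)
    then show ?thesis by (simp add: S_def L0_bar_def)
  qed
  have mF: "rep \<xi> \<in> borel_measurable F" if "\<xi> \<in> L0_set N" for \<xi> :: "('a \<Rightarrow> ennreal) set"
    using rep_measurable_F that by (simp add: N_def)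
  have zS: "z \<in> S" using z zx by (simp add: S)
  have lower: "y \<in> Lower (L0_bar N) S \<longleftrightarrow> y \<in> L0_set N \<and> (\<forall>\<xi>\<in>S. ae_le N y \<xi>)" for y
    unfolding Lower_def by (auto simp: L0_bar_def S)
  have "ae_le N z \<xi>" if "\<xi> \<in> S" for \<xi>
    using that z zleast[OF mF] by (auto simp: S N_def ae_le_iff)
  then have zlow: "z \<in> Lower (L0_bar N) S" using z lower by auto
  have great: "greatest (L0_bar N) y (Lower (L0_bar N) S) \<longleftrightarrow> y = z" for y
  proof
    assume y: "greatest (L0_bar N) y (Lower (L0_bar N) S)"
    then have "ae_le N z y" "y \<in> Lower (L0_bar N) S" using zlow by (auto simp: greatest_def L0_bar_def)
    then have yN: "y \<in> L0_set N" and "ae_le N z y" "ae_le N y z" using lower zS by auto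
    then have "AE w in N. rep y w = rep z w" unfolding ae_le_def by (auto intro: antisym)
    then have "ae_class N (rep y) = ae_class N (rep z)" using yN z by (intro ae_class_eqI) auto
    then show "y = z" using ae_class_rep[OF yN] ae_class_rep[OF z] by simp
  next
    assume "y = z"
    then show "greatest (L0_bar N) y (Lower (L0_bar N) S)"
      using zlow zS lower by (auto simp: greatest_def L0_bar_def Lower_def)
  qed
  have "Lp_norm M F \<infinity> (ae_class M x) = (SOME y. greatest (L0_bar N) y (Lower (L0_bar N) S))"
    by (simp add: Lp_norm_def Let_def inf_def S_def N_def)
  also have "\<dots> = z" by (simp add: great)
  finally show thesis using that z zx zleast by blast
qed

end

lemma borel_measurable_ennreal_powr [measurable]:
  assumes [measurable]: "f \<in> borel_measurable N"
  shows "(\<lambda>w. ennreal_powr (f w) r) \<in> borel_measurable N"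
  unfolding ennreal_powr_def by measurable

lemma enn2real_ge_1: "1 \<le> p \<Longrightarrow> p \<noteq> \<infinity> \<Longrightarrow> 1 \<le> enn2real p"
  by (cases p) auto

context prob_subalgebra
begin

section \<open>Closure properties of the unit ball\<close>

lemma cond_ball_AE:
  assumes u: "u \<in> cond_ball M F p" and v[measurable]: "v \<in> borel_measurable M" and eq: "AE w in M. u w = v w"
  shows "v \<in> cond_ball M F p"
proof (cases "p = \<infinity>")
  case True
  then have "AE w in M. \<bar>u w\<bar> \<le> 1" using u by (simp add: cond_ball_def)
  with eq have "AE w in M. \<bar>v w\<bar> \<le> 1" by eventually_elim simp
  with True v show ?thesis by (simp add: cond_ball_def)
next
  case False
  have "(\<integral>\<^sup>+w\<in>A. ennreal (\<bar>v w\<bar> powr enn2real p) \<partial>M) = (\<integral>\<^sup>+w\<in>A. ennreal (\<bar>u w\<bar> powr enn2real p) \<partial>M)" for A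
    by (rule nn_integral_cong_AE) (use eq in eventually_elim, simp)
  then show ?thesis using u v False by (simp add: cond_ball_def)
qed

lemma cond_ball_scale:
  assumes u: "u \<in> cond_ball M F p" and h: "h \<in> borel_measurable F" "\<And>w. \<bar>h w\<bar> \<le> 1"
  shows "(\<lambda>w. h w * u w) \<in> cond_ball M F p"
proof -
  have um[measurable]: "u \<in> borel_measurable M" using u by (simp add: cond_ball_def)
  have [measurable]: "h \<in> borel_measurable M" using h(1) by (rule measurable_F)
  have le: "\<bar>h w * u w\<bar> \<le> \<bar>u w\<bar>" for w using mult_right_mono[OF h(2)[of w], of "\<bar>u w\<bar>"] by (simp add: abs_mult)
  show ?thesis
  proof (cases "p = \<infinity>")
    case True
    then have "AE w in M. \<bar>u w\<bar> \<le> 1" using u by (simp add: cond_ball_def)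
    then have "AE w in M. \<bar>h w * u w\<bar> \<le> 1" by eventually_elim (rule order_trans[OF le])
    with True show ?thesis by (simp add: cond_ball_def)
  next
    case False
    have "(\<integral>\<^sup>+w\<in>A. ennreal (\<bar>h w * u w\<bar> powr enn2real p) \<partial>M) \<le> (\<integral>\<^sup>+w\<in>A. ennreal (\<bar>u w\<bar> powr enn2real p) \<partial>M)" for A
      by (intro nn_integral_mono mult_right_mono ennreal_leI powr_mono2 le) auto
    then show ?thesis using u False by (auto simp: cond_ball_def intro: order_trans)
  qed
qed

text \<open>For finite \<open>p\<close> a test set \<open>A\<close> is cut into the pieces
  \<open>C k\<close> on which the index is \<open>k\<close>. Each piece lies in \<open>F\<close>, so
  the bound for \<open>u k\<close> applies to it, and the bounds add up to the measure of
  \<open>A\<close>.\<close>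

lemma glue_closed_cond_ball: "glue_closed F (cond_ball M F p)"
  unfolding glue_closed_def
proof (intro allI impI, elim conjE)
  fix u :: "nat \<Rightarrow> 'a \<Rightarrow> real" and i :: "'a \<Rightarrow> nat"
  assume u: "\<forall>k. u k \<in> cond_ball M F p" and i[measurable]: "i \<in> measurable F (count_space UNIV)"
  have um[measurable]: "u k \<in> borel_measurable M" for k using u by (simp add: cond_ball_def)
  have iM[measurable]: "i \<in> measurable M (count_space UNIV)" using i by (rule measurable_F)
  have m: "(\<lambda>w. u (i w) w) \<in> borel_measurable M"
    using um iM by (rule measurable_compose_countable)
  show "(\<lambda>w. u (i w) w) \<in> cond_ball M F p"
  proof (cases "p = \<infinity>")
    case True
    then have "\<forall>k. AE w in M. \<bar>u k w\<bar> \<le> 1" using u by (simp add: cond_ball_def)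
    then have "AE w in M. \<forall>k. \<bar>u k w\<bar> \<le> 1" by (simp add: AE_all_countable)
    then have "AE w in M. \<bar>u (i w) w\<bar> \<le> 1" by eventually_elim simp
    with True m show ?thesis by (simp add: cond_ball_def)
  next
    case False
    have "(\<integral>\<^sup>+w\<in>A. ennreal (\<bar>u (i w) w\<bar> powr enn2real p) \<partial>M) \<le> emeasure M A" if A[measurable]: "A \<in> sets F" for A
    proof -
      have [measurable]: "A \<in> sets M" using A by (rule sets_F)
      define C where "C k = A \<inter> (i -` {k} \<inter> space M)" for k
      have C: "C k \<in> sets F" for k unfolding C_def space_F[symmetric] by measurable
      then have CM[measurable]: "C k \<in> sets M" for k by (rule sets_F)
      have "(\<integral>\<^sup>+w\<in>A. ennreal (\<bar>u (i w) w\<bar> powr enn2real p) \<partial>M) =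
          (\<integral>\<^sup>+w. (\<Sum>k. ennreal (\<bar>u k w\<bar> powr enn2real p) * indicator (C k) w) \<partial>M)"
      proof (rule nn_integral_cong)
        fix w assume "w \<in> space M"
        then have "(\<Sum>k. ennreal (\<bar>u k w\<bar> powr enn2real p) * indicator (C k) w) =
          (\<Sum>k\<in>{i w}. ennreal (\<bar>u k w\<bar> powr enn2real p) * indicator (C k) w)"
          by (intro suminf_finite) (auto simp: C_def split: split_indicator)
        also have "\<dots> = ennreal (\<bar>u (i w) w\<bar> powr enn2real p) * indicator A w"
          using \<open>w \<in> space M\<close> by (simp add: C_def indicator_def)
        finally show "ennreal (\<bar>u (i w) w\<bar> powr enn2real p) * indicator A w =
          (\<Sum>k. ennreal (\<bar>u k w\<bar> powr enn2real p) * indicator (C k) w)" ..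
      qed
      also have "\<dots> = (\<Sum>k. \<integral>\<^sup>+w\<in>C k. ennreal (\<bar>u k w\<bar> powr enn2real p) \<partial>M)"
        by (rule nn_integral_suminf) measurable
      also have "\<dots> \<le> (\<Sum>k. emeasure M (C k))"
        using u False C by (intro suminf_le) (auto simp: cond_ball_def)
      also have "\<dots> = emeasure M (\<Union>k. C k)"
        by (rule suminf_emeasure) (auto simp: disjoint_family_on_def C_def)
      also have "(\<Union>k. C k) = A" using subset_space[OF A] by (auto simp: C_def)
      finally show ?thesis .
    qed
    then show ?thesis using m False by (simp add: cond_ball_def)
  qed
qed

text \<open>For finite \<open>p\<close>, half the larger of \<open>|a|\<close> and
  \<open>|b|\<close> bounds \<open>|(a + b) / 4|\<close>, and for \<open>r \<ge> 1\<close> the power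
  of this half is at most half the sum of the two powers. Integration over a test set then gives the
  bound.\<close>

lemma cond_ball_add:
  assumes p: "1 \<le> p" and u: "u \<in> cond_ball M F p" and v: "v \<in> cond_ball M F p"
  shows "(\<lambda>w. (u w + v w) / 4) \<in> cond_ball M F p"
proof -
  have m[measurable]: "u \<in> borel_measurable M" "v \<in> borel_measurable M" using u v by (auto simp: cond_ball_def)
  show ?thesis
  proof (cases "p = \<infinity>")
    case True
    then have "AE w in M. \<bar>u w\<bar> \<le> 1" "AE w in M. \<bar>v w\<bar> \<le> 1" using u v by (simp_all add: cond_ball_def)
    then have "AE w in M. \<bar>(u w + v w) / 4\<bar> \<le> 1" by eventually_elim (simp add: abs_le_iff)
    with True show ?thesis by (simp add: cond_ball_def)
  next
    case False
    define r where "r = enn2real p"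
    have r: "1 \<le> r" unfolding r_def using p False by (rule enn2real_ge_1)
    have le: "2 * \<bar>(a + b) / 4\<bar> powr r \<le> \<bar>a\<bar> powr r + \<bar>b\<bar> powr r" for a b :: real
    proof -
      have "\<bar>(a + b) / 4\<bar> powr r \<le> (1/2 * max \<bar>a\<bar> \<bar>b\<bar>) powr r"
        using r by (intro powr_mono2) auto
      also have "\<dots> = (1/2) powr r * max \<bar>a\<bar> \<bar>b\<bar> powr r" by (rule powr_mult)
      also have "\<dots> \<le> 1/2 * max \<bar>a\<bar> \<bar>b\<bar> powr r"
        using powr_mono'[of 1 r "1/2::real"] r by (intro mult_right_mono) auto
      also have "max \<bar>a\<bar> \<bar>b\<bar> powr r \<le> \<bar>a\<bar> powr r + \<bar>b\<bar> powr r"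
        by (simp add: max_def)
      finally show ?thesis by simp
    qed
    have "(\<integral>\<^sup>+w\<in>A. ennreal (\<bar>(u w + v w) / 4\<bar> powr r) \<partial>M) \<le> emeasure M A" if A: "A \<in> sets F" for A
    proof -
      have [measurable]: "A \<in> sets M" using A by (rule sets_F)
      have "2 * (\<integral>\<^sup>+w\<in>A. ennreal (\<bar>(u w + v w) / 4\<bar> powr r) \<partial>M) =
          (\<integral>\<^sup>+w\<in>A. ennreal (2 * \<bar>(u w + v w) / 4\<bar> powr r) \<partial>M)"
        by (subst nn_integral_cmult[symmetric]) (auto simp: ennreal_mult mult.assoc)
      also have "\<dots> \<le> (\<integral>\<^sup>+w. ennreal (\<bar>u w\<bar> powr r) * indicator A w + ennreal (\<bar>v w\<bar> powr r) * indicator A w \<partial>M)"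
        by (intro nn_integral_mono)
          (use le in \<open>auto simp: ennreal_plus[symmetric] simp del: ennreal_plus intro!: ennreal_leI split: split_indicator\<close>)
      also have "\<dots> = (\<integral>\<^sup>+w\<in>A. ennreal (\<bar>u w\<bar> powr r) \<partial>M) + (\<integral>\<^sup>+w\<in>A. ennreal (\<bar>v w\<bar> powr r) \<partial>M)"
        by (rule nn_integral_add) measurable
      also have "\<dots> \<le> emeasure M A + emeasure M A"
        using u v A False by (intro add_mono) (auto simp: cond_ball_def r_def)
      also have "\<dots> = 2 * emeasure M A" by (simp add: mult_2)
      finally show ?thesis by (subst (asm) ennreal_mult_le_mult_iff) auto
    qed
    then show ?thesis using False by (simp add: cond_ball_def r_def)
  qed
qed

text \<open>For finite \<open>p\<close> this is Fatou's lemma on each test set of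
  \<open>F\<close>.\<close>

lemma cond_ball_lim:
  assumes us: "\<And>n::nat. us n \<in> cond_ball M F p" and u[measurable]: "u \<in> borel_measurable M"
    and lim: "AE w in M. (\<lambda>n. us n w) \<longlonglongrightarrow> u w"
  shows "u \<in> cond_ball M F p"
proof -
  have m[measurable]: "us n \<in> borel_measurable M" for n using us[of n] by (simp add: cond_ball_def)
  show ?thesis
  proof (cases "p = \<infinity>")
    case True
    then have "\<And>n. AE w in M. \<bar>us n w\<bar> \<le> 1" using us by (simp add: cond_ball_def)
    then have "AE w in M. \<forall>n. \<bar>us n w\<bar> \<le> 1" by (simp add: AE_all_countable)
    with lim have "AE w in M. \<bar>u w\<bar> \<le> 1"
    proof eventually_elim
      case (elim w)
      then show ?case by (intro LIMSEQ_le_const2[OF tendsto_rabs[OF elim(1)]]) auto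
    qed
    with True show ?thesis by (simp add: cond_ball_def)
  next
    case False
    define r where "r = enn2real p"
    have "(\<integral>\<^sup>+w\<in>A. ennreal (\<bar>u w\<bar> powr r) \<partial>M) \<le> emeasure M A" if A: "A \<in> sets F" for A
    proof -
      have [measurable]: "A \<in> sets M" using A by (rule sets_F)
      have "(\<integral>\<^sup>+w\<in>A. ennreal (\<bar>u w\<bar> powr r) \<partial>M) \<le> (\<integral>\<^sup>+w. liminf (\<lambda>n. ennreal (\<bar>us n w\<bar> powr r) * indicator A w) \<partial>M)"
      proof (rule nn_integral_mono_AE, use lim in eventually_elim)
        fix w assume lim: "(\<lambda>n. us n w) \<longlonglongrightarrow> u w"
        show "ennreal (\<bar>u w\<bar> powr r) * indicator A w \<le> liminf (\<lambda>n. ennreal (\<bar>us n w\<bar> powr r) * indicator A w)"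
        \<comment> \<open>Continuity of \<open>powr\<close> in its base is used away from 0; at 0
          the left-hand side vanishes.\<close>
        proof (cases "u w = 0")
          case False
          then have "(\<lambda>n. ennreal (\<bar>us n w\<bar> powr r)) \<longlonglongrightarrow> ennreal (\<bar>u w\<bar> powr r)"
            by (intro tendsto_intros lim) auto
          then have "(\<lambda>n. ennreal (\<bar>us n w\<bar> powr r) * indicator A w) \<longlonglongrightarrow> ennreal (\<bar>u w\<bar> powr r) * indicator A w"
            by (auto split: split_indicator)
          then show ?thesis by (simp add: lim_imp_Liminf)
        qed simp
      qed
      also have "\<dots> \<le> liminf (\<lambda>n. \<integral>\<^sup>+w\<in>A. ennreal (\<bar>us n w\<bar> powr r) \<partial>M)"
        by (rule nn_integral_liminf) measurable
      also have "\<dots> \<le> limsup (\<lambda>n. \<integral>\<^sup>+w\<in>A. ennreal (\<bar>us n w\<bar> powr r) \<partial>M)"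
        by (rule Liminf_le_Limsup) simp
      also have "\<dots> \<le> emeasure M A"
        using us A False by (intro Limsup_bounded) (auto simp: cond_ball_def r_def)
      finally show ?thesis .
    qed
    then show ?thesis using False by (simp add: cond_ball_def r_def)
  qed
qed

text \<open>For finite \<open>p\<close>, integrating \<open>|a| \<le> 1 + |a| powr r\<close> over
  the whole space, itself a test set, gives at most 1 + 1.\<close>

lemma cond_ball_integral:
  assumes p: "1 \<le> p" and u: "u \<in> cond_ball M F p"
  shows "(\<integral>\<^sup>+w. ennreal \<bar>u w\<bar> \<partial>M) \<le> 2"
proof -
  have [measurable]: "u \<in> borel_measurable M" using u by (auto simp: cond_ball_def)
  show ?thesis
  proof (cases "p = \<infinity>")
    case True
    then have "AE w in M. \<bar>u w\<bar> \<le> 1" using u by (simp add: cond_ball_def)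
    then have "(\<integral>\<^sup>+w. ennreal \<bar>u w\<bar> \<partial>M) \<le> (\<integral>\<^sup>+w. 1 \<partial>M)"
      by (intro nn_integral_mono_AE) (elim eventually_mono, simp)
    also have "\<dots> \<le> 2" by (simp add: emeasure_space_1)
    finally show ?thesis .
  next
    case False
    define r where "r = enn2real p"
    have r: "1 \<le> r" unfolding r_def using p False by (rule enn2real_ge_1)
    have "\<bar>a\<bar> \<le> 1 + \<bar>a\<bar> powr r" for a :: real
    proof (cases "\<bar>a\<bar> \<le> 1")
      case False
      then have "\<bar>a\<bar> powr 1 \<le> \<bar>a\<bar> powr r" using r by (intro powr_mono) auto
      with False show ?thesis by simp
    qed (simp add: add_increasing2)
    then have "(\<integral>\<^sup>+w. ennreal \<bar>u w\<bar> \<partial>M) \<le> (\<integral>\<^sup>+w. 1 + ennreal (\<bar>u w\<bar> powr r) \<partial>M)"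
      by (intro nn_integral_mono) (simp add: ennreal_1[symmetric] ennreal_plus[symmetric] ennreal_leI del: ennreal_1 ennreal_plus)
    also have "\<dots> = 1 + (\<integral>\<^sup>+w. ennreal (\<bar>u w\<bar> powr r) \<partial>M)"
      by (subst nn_integral_add) (auto simp: emeasure_space_1)
    also have "(\<integral>\<^sup>+w. ennreal (\<bar>u w\<bar> powr r) \<partial>M) = (\<integral>\<^sup>+w\<in>space M. ennreal (\<bar>u w\<bar> powr r) \<partial>M)"
      by (intro nn_integral_cong) simp
    also have "1 + \<dots> \<le> 1 + emeasure M (space M)"
      using u False sets.top[of F] by (intro add_left_mono) (auto simp: cond_ball_def r_def space_F)
    also have "\<dots> = 2" by (simp add: emeasure_space_1)
    finally show ?thesis .
  qed
qed

section \<open>Norm inequalities as membership in the ball\<close>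

lemma Lp_norm_in_L0:
  assumes "x \<in> borel_measurable M"
  shows "Lp_norm M F p (ae_class M x) \<in> L0_set (restr_to_subalg M F)"
proof (cases "p = \<infinity>")
  case True
  then show ?thesis using Lp_norm_infinity[OF assms] by metis
next
  case False
  have "(\<lambda>w. ennreal_powr (nn_cond_exp M F f w) c) \<in> borel_measurable (restr_to_subalg M F)" for f c
    unfolding measurable_N_iff by measurable
  then show ?thesis using False by (simp add: Lp_norm_def Let_def)
qed

text \<open>The bridge from the order on classes to functions. For infinite \<open>p\<close> it
  rests on leastness of the essential upper bound, for finite \<open>p\<close> on the integral test,
  followed by a change from the chosen representative to \<open>x\<close>.\<close>

lemma Lp_norm_le_iff:
  assumes p: "1 \<le> p" and x[measurable]: "x \<in> borel_measurable M" and e: "e \<in> pos_functions F"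
  defines "N \<equiv> restr_to_subalg M F"
  shows "ae_le N (Lp_norm M F p (ae_class M x)) (L0_ennreal N (ae_class N e)) \<longleftrightarrow>
    (\<lambda>w. x w / e w) \<in> cond_ball M F p"
proof -
  have em[measurable]: "e \<in> borel_measurable F" and epos: "0 < e w" for w using e by (auto dest: pos_functionsD)
  have emM[measurable]: "e \<in> borel_measurable M" using em by (rule measurable_F)
  let ?n = "Lp_norm M F p (ae_class M x)"
  have nm[measurable]: "rep ?n \<in> borel_measurable F"
    using Lp_norm_in_L0[OF x] by (intro rep_measurable_F)
  have "rep (ae_class N e) \<in> borel_measurable N"
    using em by (intro rep_measurable ae_class_in_L0) (simp add: N_def measurable_N_iff)
  then have rem[measurable]: "rep (ae_class N e) \<in> borel_measurable F" by (simp add: N_def measurable_N_iff)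
  have re: "AE w in M. rep (ae_class N e) w = e w"
    unfolding N_def using em by (rule rep_ae_class_F)
  have em': "(\<lambda>w. ennreal (rep (ae_class N e) w)) \<in> borel_measurable F" by measurable
  have rE: "AE w in M. rep (L0_ennreal N (ae_class N e)) w = ennreal (e w)"
    using rep_ae_class_F[OF em'] re unfolding L0_ennreal_def N_def[symmetric] by eventually_elim simp
  have "L0_ennreal N (ae_class N e) \<in> L0_set N"
    unfolding L0_ennreal_def by (rule ae_class_in_L0) (use em' in \<open>simp add: N_def measurable_N_iff\<close>)
  then have "ae_le N ?n (L0_ennreal N (ae_class N e)) \<longleftrightarrow> (AE w in M. rep ?n w \<le> rep (L0_ennreal N (ae_class N e)) w)"
    using Lp_norm_in_L0[OF x] unfolding N_def by (intro ae_le_iff)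
  also have "\<dots> \<longleftrightarrow> (AE w in M. rep ?n w \<le> ennreal (e w))"
    by (rule eventually_subst) (use rE in eventually_elim, simp)
  also have "\<dots> \<longleftrightarrow> (\<lambda>w. x w / e w) \<in> cond_ball M F p"
  proof (cases "p = \<infinity>")
    case True
    obtain z where z: "?n = z" "AE w in M. ennreal \<bar>x w\<bar> \<le> rep z w"
      "\<And>h. h \<in> borel_measurable F \<Longrightarrow> AE w in M. ennreal \<bar>x w\<bar> \<le> h w \<Longrightarrow> AE w in M. rep z w \<le> h w"
      using Lp_norm_infinity[OF x] True by metis
    have "(AE w in M. rep z w \<le> ennreal (e w)) \<longleftrightarrow> (AE w in M. ennreal \<bar>x w\<bar> \<le> ennreal (e w))"
    proof
      assume "AE w in M. rep z w \<le> ennreal (e w)"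
      with z(2) show "AE w in M. ennreal \<bar>x w\<bar> \<le> ennreal (e w)" by eventually_elim (rule order_trans)
    next
      assume "AE w in M. ennreal \<bar>x w\<bar> \<le> ennreal (e w)"
      then show "AE w in M. rep z w \<le> ennreal (e w)" by (intro z(3)) measurable
    qed
    also have "\<dots> \<longleftrightarrow> (AE w in M. \<bar>x w / e w\<bar> \<le> 1)"
      using epos by (simp add: field_simps less_imp_le)
    finally show ?thesis unfolding z(1) using True by (simp add: cond_ball_def)
  next
    case False
    let ?x = "rep (ae_class M x)"
    have xm[measurable]: "?x \<in> borel_measurable M" by simp
    have rx: "AE w in M. ?x w = x w" using x by (rule rep_ae_class)
    let ?g = "\<lambda>w. ennreal_powr (nn_cond_exp M F (\<lambda>v. ennreal (\<bar>?x v\<bar> powr enn2real p)) w) (1 / enn2real p)"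
    have "?n = ae_class N ?g" using False by (simp add: Lp_norm_def Let_def N_def)
    moreover have "AE w in M. rep (ae_class N ?g) w = ?g w"
      unfolding N_def by (rule rep_ae_class_F) measurable
    ultimately have rn: "AE w in M. rep ?n w = ?g w" by simp
    have "(AE w in M. rep ?n w \<le> ennreal (e w)) \<longleftrightarrow> (AE w in M. ?g w \<le> ennreal (e w))"
      by (rule eventually_subst) (use rn in eventually_elim, simp)
    also have "\<dots> \<longleftrightarrow> (\<lambda>w. ?x w / e w) \<in> cond_ball M F p"
      using p False xm e by (rule cond_ball_norm_finite)
    also have "\<dots> \<longleftrightarrow> (\<lambda>w. x w / e w) \<in> cond_ball M F p"
    proof -
      have m: "(\<lambda>w. ?x w / e w) \<in> borel_measurable M" "(\<lambda>w. x w / e w) \<in> borel_measurable M" by measurable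
      have "AE w in M. ?x w / e w = x w / e w" "AE w in M. x w / e w = ?x w / e w"
        using rx by (auto elim!: eventually_mono)
      then show ?thesis using m by (blast intro: cond_ball_AE)
    qed
    finally show ?thesis .
  qed
  finally show ?thesis .
qed

end

section \<open>Barrels in the module\<close>

locale Lp_subalgebra = prob_subalgebra +
  fixes p :: ennreal
  assumes p: "1 \<le> p"
begin

abbreviation N where "N \<equiv> restr_to_subalg M F"
abbreviation E where "E \<equiv> Lp_module M F p"
abbreviation U where "U \<equiv> cond_ball M F p"

lemma cond_ball_zero: "(\<lambda>_. 0) \<in> U"
  by (auto simp: cond_ball_def)

lemma cond_ball_mono:
  assumes f: "(\<lambda>w. f w / d w) \<in> U" and d: "d \<in> pos_functions F" and e: "e \<in> pos_functions F"
    and le: "\<And>w. d w \<le> e w"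
  shows "(\<lambda>w. f w / e w) \<in> U"
proof -
  have [measurable]: "d \<in> borel_measurable F" "e \<in> borel_measurable F" and pos: "0 < d w" "0 < e w" for w
    using d e by (auto dest: pos_functionsD)
  have "(\<lambda>w. d w / e w * (f w / d w)) \<in> U"
  proof (rule cond_ball_scale[OF f])
    show "\<bar>d w / e w\<bar> \<le> 1" for w using pos[of w] le[of w] by simp
  qed measurable
  moreover have "d w / e w * (f w / d w) = f w / e w" for w using pos(1)[of w] by simp
  ultimately show ?thesis by (simp only:)
qed

lemma pos_functions_cmult:
  assumes e: "e \<in> pos_functions F" and c: "0 < c"
  shows "(\<lambda>w. c * e w) \<in> pos_functions F"
proof -
  have [measurable]: "e \<in> borel_measurable F" using e by (rule pos_functionsD)
  have "(\<lambda>w. c * e w) \<in> borel_measurable F" by measurable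
  then show ?thesis using c pos_functionsD(2)[OF e] by (simp add: pos_functions_def)
qed

lemma pos_functions_borel_N: "e \<in> pos_functions F \<Longrightarrow> e \<in> borel_measurable N"
  by (simp add: pos_functions_def measurable_N_iff)

lemma cond_ball_mult_measurable:
  assumes "e \<in> pos_functions F" "u \<in> U"
  shows "(\<lambda>w. e w * u w) \<in> borel_measurable M"
proof -
  have "e \<in> borel_measurable M" using assms(1) by (intro measurable_F) (rule pos_functionsD)
  moreover have "u \<in> borel_measurable M" using assms(2) by (simp add: cond_ball_def)
  ultimately show ?thesis by (rule borel_measurable_times)
qed

lemma ae_class_pos: 
  assumes "e \<in> pos_functions F" shows "ae_class N e \<in> L0_pos N"
proof -
  have e: "e \<in> borel_measurable N" using assms by (rule pos_functions_borel_N)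
  have "AE w in N. 0 < rep (ae_class N e) w"
    using rep_ae_class[OF e] by eventually_elim (simp add: pos_functionsD(2)[OF assms])
  then show ?thesis using e by (simp add: L0_pos_def)
qed

lemma L0_pos_cases:
  assumes "X \<in> L0_pos N"
  obtains e where "e \<in> pos_functions F" "X = ae_class N e"
proof
  \<comment> \<open>The default 1 replaces non-positive values of the representative, which occur
    only on a null set.\<close>
  let ?e = "\<lambda>w. if 0 < rep X w then rep X w else 1"
  have X: "X \<in> L0_set N" "AE w in N. 0 < rep X w" using assms by (auto simp: L0_pos_def L0_def)
  then have [measurable]: "rep X \<in> borel_measurable F" by (intro rep_measurable_F)
  then show e: "?e \<in> pos_functions F" by (simp add: pos_functions_def)
  have "ae_class N (rep X) = ae_class N ?e"
    by (rule ae_class_eqI) (use X pos_functions_borel_N[OF e] in \<open>auto elim: eventually_mono\<close>)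
  then show "X = ae_class N ?e" using ae_class_rep[OF X(1)] by simp
qed

lemma ae_le_abs:
  assumes "h \<in> borel_measurable F" "e \<in> borel_measurable F" "\<And>w. \<bar>h w\<bar> \<le> e w"
  shows "ae_le N (L0_abs N (ae_class N h)) (ae_class N e)"
proof -
  have [measurable]: "h \<in> borel_measurable N" "e \<in> borel_measurable N" using assms by (simp_all add: measurable_N_iff)
  have [measurable]: "rep (ae_class N h) \<in> borel_measurable N" by simp
  have "AE w in N. rep (L0_abs N (ae_class N h)) w = \<bar>rep (ae_class N h) w\<bar>"
    unfolding L0_abs_def by (rule rep_ae_class) measurable
  moreover have "AE w in N. rep (ae_class N h) w = h w" "AE w in N. rep (ae_class N e) w = e w"
    by (rule rep_ae_class, measurable)+
  ultimately show ?thesis unfolding ae_le_def by eventually_elim (simp add: assms(3))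
qed

lemma L0_ennreal_in_L0: "X \<in> L0_set N \<Longrightarrow> L0_ennreal N X \<in> L0_set N"
  unfolding L0_ennreal_def using rep_measurable[of X N]
  by (intro ae_class_in_L0 measurable_compose[OF _ measurable_ennreal])

lemma rep_L0_ennreal: "X \<in> L0_set N \<Longrightarrow> AE w in M. rep (L0_ennreal N X) w = ennreal (rep X w)"
  unfolding L0_ennreal_def
  by (intro rep_ae_class_F measurable_compose[OF rep_measurable_F measurable_ennreal])

lemma carrier_cases:
  assumes "x \<in> carrier E"
  obtains f where "f \<in> borel_measurable M" "x = ae_class M f"
proof -
  have "x \<in> carrier (L0 M)" using assms by (simp add: Lp_module_def)
  then show thesis by (rule L0_cases) (rule that)
qed

text \<open>A real norm is dominated by its absolute value plus 1, which is strictly positive.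
  Conversely a norm below \<open>e\<close> is finite almost surely, and \<open>enn2real\<close>
  supplies the non-negative real class that the carrier asks for.\<close>

lemma carrier_iff:
  assumes x: "x \<in> borel_measurable M"
  shows "ae_class M x \<in> carrier E \<longleftrightarrow> (\<exists>e\<in>pos_functions F. (\<lambda>w. x w / e w) \<in> U)"
proof
  let ?n = "Lp_norm M F p (ae_class M x)"
  assume "ae_class M x \<in> carrier E"
  then obtain X where X: "X \<in> L0_set N" and n: "?n = L0_ennreal N X"
    by (auto simp: Lp_module_def L0_nonneg_def L0_def)
  have [measurable]: "rep X \<in> borel_measurable F" using X by (rule rep_measurable_F)
  define e where "e w = \<bar>rep X w\<bar> + 1" for w
  have "e \<in> borel_measurable F" unfolding e_def by measurable
  then have e: "e \<in> pos_functions F" by (simp add: pos_functions_def e_def add_nonneg_pos)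
  have Xe: "rep X w \<le> e w" for w by (simp add: e_def)
  have eL: "ae_class N e \<in> L0_set N" using pos_functions_borel_N[OF e] by simp
  have "AE w in M. rep (ae_class N e) w = e w" using pos_functionsD(1)[OF e] by (rule rep_ae_class_F)
  with rep_L0_ennreal[OF X] rep_L0_ennreal[OF eL]
  have "AE w in M. rep (L0_ennreal N X) w \<le> rep (L0_ennreal N (ae_class N e)) w"
    by eventually_elim (simp add: Xe ennreal_leI)
  then have "ae_le N ?n (L0_ennreal N (ae_class N e))"
    unfolding n by (simp add: ae_le_iff L0_ennreal_in_L0 X eL)
  then have "(\<lambda>w. x w / e w) \<in> U" using Lp_norm_le_iff[OF p x e] by simp
  then show "\<exists>e\<in>pos_functions F. (\<lambda>w. x w / e w) \<in> U" using e by blast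
next
  let ?n = "Lp_norm M F p (ae_class M x)"
  assume "\<exists>e\<in>pos_functions F. (\<lambda>w. x w / e w) \<in> U"
  then obtain e where e: "e \<in> pos_functions F" and "(\<lambda>w. x w / e w) \<in> U" by blast
  then have le: "ae_le N ?n (L0_ennreal N (ae_class N e))" using Lp_norm_le_iff[OF p x e] by simp
  have n: "?n \<in> L0_set N" using x by (rule Lp_norm_in_L0)
  have rn: "rep ?n \<in> borel_measurable N" using n by simp
  have [measurable]: "rep ?n \<in> borel_measurable F" using n by (rule rep_measurable_F)
  have eL: "ae_class N e \<in> L0_set N" using pos_functions_borel_N[OF e] by simp
  have fin: "AE w in M. rep ?n w \<noteq> \<infinity>"
    using le[unfolded ae_le_iff[OF n L0_ennreal_in_L0[OF eL]]] rep_L0_ennreal[OF eL]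
    by eventually_elim (auto simp: top_unique)
  define X where "X = ae_class N (\<lambda>w. enn2real (rep ?n w))"
  have Xm: "(\<lambda>w. enn2real (rep ?n w)) \<in> borel_measurable N" using rn by measurable
  then have X: "X \<in> L0_set N" unfolding X_def by simp
  have rX: "AE w in N. rep X w = enn2real (rep ?n w)" unfolding X_def using Xm by (rule rep_ae_class)
  then have "AE w in N. 0 \<le> rep X w" by eventually_elim simp
  then have "X \<in> L0_nonneg N" using X by (simp add: L0_nonneg_def L0_def)
  moreover have "L0_ennreal N X = ?n"
  proof -
    have "AE w in N. rep ?n w \<noteq> \<infinity>"
      by (rule AE_N_iff[THEN iffD2, OF _ fin]) measurable
    with rX have "AE w in N. ennreal (rep X w) = rep ?n w" by eventually_elim (simp add: less_top[symmetric])
    then have "ae_class N (\<lambda>w. ennreal (rep X w)) = ae_class N (rep ?n)"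
      using rep_measurable[OF X] rn by (intro ae_class_eqI measurable_compose[OF _ measurable_ennreal])
    then show ?thesis by (simp add: L0_ennreal_def ae_class_rep[OF n])
  qed
  ultimately have "?n \<in> L0_ennreal N ` L0_nonneg N" by force
  then show "ae_class M x \<in> carrier E" using x by (simp add: Lp_module_def)
qed

lemma carrierI:
  assumes "x \<in> borel_measurable M" "e \<in> pos_functions F" "(\<lambda>w. x w / e w) \<in> U"
  shows "ae_class M x \<in> carrier E"
  unfolding carrier_iff[OF assms(1)] using assms(3,2) by (rule bexI[where x = e])

lemma smult_class: "h \<in> borel_measurable F \<Longrightarrow> f \<in> borel_measurable M \<Longrightarrow>
    ae_class N h \<odot>\<^bsub>E\<^esub> ae_class M f = ae_class M (\<lambda>w. h w * f w)"
  using L0_module_smult[OF sub, of h f] by (simp add: Lp_module_def measurable_N_iff)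

lemma add_class: "f \<in> borel_measurable M \<Longrightarrow> g \<in> borel_measurable M \<Longrightarrow>
    ae_class M f \<oplus>\<^bsub>E\<^esub> ae_class M g = ae_class M (\<lambda>w. f w + g w)"
  using L0_add[of f M g] by (simp add: Lp_module_def)

lemma zero_class: "\<zero>\<^bsub>E\<^esub> = ae_class M (\<lambda>_. 0)"
  by (simp add: Lp_module_def L0_zero)

text \<open>The quarter of \<open>cond_ball_add\<close> reappears as a fourfold larger radius; this
  takes the place of the triangle inequality in the module and its topology.\<close>

lemma cond_ball_add_quotient:
  assumes "(\<lambda>w. f w / (e w / 4)) \<in> U" "(\<lambda>w. g w / (e w / 4)) \<in> U"
  shows "(\<lambda>w. (f w + g w) / e w) \<in> U"
proof -
  have "(f w / (e w / 4) + g w / (e w / 4)) / 4 = (f w + g w) / e w" for w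
    by (cases "e w = 0") (simp_all add: field_simps)
  then show ?thesis using cond_ball_add[OF p assms] by (simp only:)
qed

lemma carrier_add:
  assumes "x \<in> carrier E" "y \<in> carrier E"
  shows "x \<oplus>\<^bsub>E\<^esub> y \<in> carrier E"
proof -
  obtain f where f: "f \<in> borel_measurable M" "x = ae_class M f" using assms(1) by (rule carrier_cases)
  obtain g where g: "g \<in> borel_measurable M" "y = ae_class M g" using assms(2) by (rule carrier_cases)
  obtain d where d: "d \<in> pos_functions F" "(\<lambda>w. f w / d w) \<in> U" using assms(1) f carrier_iff by blast
  obtain e where e: "e \<in> pos_functions F" "(\<lambda>w. g w / e w) \<in> U" using assms(2) g carrier_iff by blast
  have [measurable]: "d \<in> borel_measurable F" "e \<in> borel_measurable F" and pos: "0 < d w" "0 < e w" for w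
    using d e by (auto dest: pos_functionsD)
  \<comment> \<open>A common radius for both summands; their sum then has radius
    \<open>4 * c\<close>.\<close>
  define c where "c w = d w + e w" for w
  have "c \<in> borel_measurable F" unfolding c_def by measurable
  then have c: "c \<in> pos_functions F" using pos by (simp add: pos_functions_def c_def add_pos_pos)
  have "(\<lambda>w. f w / c w) \<in> U" using d(2,1) c by (rule cond_ball_mono) (simp add: c_def less_imp_le[OF pos(2)])
  moreover have "(\<lambda>w. g w / c w) \<in> U" using e(2,1) c by (rule cond_ball_mono) (simp add: c_def less_imp_le[OF pos(1)])
  ultimately have U: "(\<lambda>w. (f w + g w) / (4 * c w)) \<in> U"
    using cond_ball_add_quotient[of f "\<lambda>w. 4 * c w" g] by simp
  have "ae_class M (\<lambda>w. f w + g w) \<in> carrier E"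
    using borel_measurable_add[OF f(1) g(1)] pos_functions_cmult[OF c, of 4] U by (intro carrierI) auto
  then show ?thesis using f g by (simp add: add_class)
qed

section \<open>The topology of the module\<close>

lemma openin_Lp: "openin (Lp_topology M F p) V \<longleftrightarrow> V \<subseteq> carrier E \<and>
   (\<forall>x\<in>V. \<exists>\<epsilon>\<in>L0_pos N. \<forall>u\<in>carrier E. ae_le N (Lp_norm M F p u) (L0_ennreal N \<epsilon>) \<longrightarrow> x \<oplus>\<^bsub>E\<^esub> u \<in> V)"
  unfolding Lp_topology_def by (rule openin_L0_norm_topology)

lemma openin_carrier: "openin (Lp_topology M F p) (carrier E)"
proof -
  have "ae_class N (\<lambda>_. 1) \<in> L0_pos N" by (rule ae_class_pos) (simp add: pos_functions_const)
  then show ?thesis unfolding openin_Lp using carrier_add by blast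
qed

lemma topspace_Lp: "topspace (Lp_topology M F p) = carrier E"
  using openin_carrier openin_Lp[of "topspace (Lp_topology M F p)"] openin_subset by blast

section \<open>From barrels to sets of functions\<close>

text \<open>The conditions on \<open>U\<close> are the closure properties of the ball. For
  \<open>B\<close>, balancedness gives \<open>B_scale\<close>, convexity at 1/2 the midpoint,
  concatenation the gluing, and an open complement \<open>B_closed\<close>; absorption, with its
  bound itself as multiplier, gives \<open>B_absorb\<close>.\<close>

lemma module_barrel_barrel:
  assumes barrel: "L0_barrel N E (Lp_topology M F p) B" and concat: "countable_concatenation N E B"
  shows "module_barrel M F U {f \<in> borel_measurable M. ae_class M f \<in> B}"
proof -
  have bal: "L0_balanced N E B" and abs: "L0_absorbent N E B" and conv: "L0_convex N E B"
    and closed: "closedin (Lp_topology M F p) B" using barrel by (auto simp: L0_barrel_def)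
  have sub_E: "B \<subseteq> carrier E" using bal by (simp add: L0_balanced_def)
  have one: "\<one>\<^bsub>L0 N\<^esub> = ae_class N (\<lambda>_. 1)" by (rule L0_one)
  show ?thesis
  proof
    show "u \<in> borel_measurable M" if "u \<in> U" for u using that by (simp add: cond_ball_def)
    show "(\<lambda>_. 0) \<in> U" by (rule cond_ball_zero)
    show "(\<lambda>w. h w * u w) \<in> U" if "u \<in> U" "h \<in> borel_measurable F" "\<And>w. \<bar>h w\<bar> \<le> 1" for u h
      using that by (rule cond_ball_scale)
    show "glue_closed F U" by (rule glue_closed_cond_ball)
    show "(\<lambda>w. (u w + v w) / 4) \<in> U" if "u \<in> U" "v \<in> U" for u v using p that by (rule cond_ball_add)
    show "u \<in> U" if "\<And>n::nat. us n \<in> U" "u \<in> borel_measurable M" "AE w in M. (\<lambda>n. us n w) \<longlonglongrightarrow> u w" for us u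
      using that by (rule cond_ball_lim)
    show "(\<integral>\<^sup>+w. ennreal \<bar>u w\<bar> \<partial>M) \<le> 2" if "u \<in> U" for u using p that by (rule cond_ball_integral)
    show "f \<in> borel_measurable M" if "f \<in> {f \<in> borel_measurable M. ae_class M f \<in> B}" for f using that by simp
    show "g \<in> {f \<in> borel_measurable M. ae_class M f \<in> B}"
      if "f \<in> {f \<in> borel_measurable M. ae_class M f \<in> B}" "g \<in> borel_measurable M" "AE w in M. f w = g w" for f g
      using that ae_class_eqI[of f M g] by simp
    show "(\<lambda>w. h w * f w) \<in> {f \<in> borel_measurable M. ae_class M f \<in> B}"
      if f: "f \<in> {f \<in> borel_measurable M. ae_class M f \<in> B}" and h: "h \<in> borel_measurable F" "\<And>w. \<bar>h w\<bar> \<le> 1" for f h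
    proof -
      have "ae_class N h \<odot>\<^bsub>E\<^esub> ae_class M f \<in> B"
        using bal f h ae_le_abs[OF h(1) _ h(2)] by (auto simp: L0_balanced_def one measurable_N_iff)
      moreover have fm: "f \<in> borel_measurable M" using f by simp
      moreover have "(\<lambda>w. h w * f w) \<in> borel_measurable M"
        using measurable_F[OF h(1)] fm by (rule borel_measurable_times)
      ultimately show ?thesis using h(1) by (simp add: smult_class)
    qed
    show "(\<lambda>w. (f w + g w) / 2) \<in> {f \<in> borel_measurable M. ae_class M f \<in> B}"
      if f: "f \<in> {f \<in> borel_measurable M. ae_class M f \<in> B}" and g: "g \<in> {f \<in> borel_measurable M. ae_class M f \<in> B}" for f g
    proof -
      interpret R: cring "L0 N" by (rule cring_L0)
      let ?h = "ae_class N (\<lambda>_. 1/2 :: real)"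
      have h: "?h \<in> carrier (L0 N)" by simp
      have "\<one>\<^bsub>L0 N\<^esub> = ?h \<oplus>\<^bsub>L0 N\<^esub> ?h" by (simp add: one L0_add)
      then have "\<one>\<^bsub>L0 N\<^esub> \<ominus>\<^bsub>L0 N\<^esub> ?h = ?h" using h by (simp add: R.minus_eq R.a_assoc R.r_neg)
      moreover have half: "AE w in N. rep ?h w = 1/2" by (rule rep_ae_class) simp
      then have "AE w in N. 0 \<le> rep ?h w" by eventually_elim simp
      then have "?h \<in> L0_nonneg N" by (simp add: L0_nonneg_def)
      moreover have "AE w in N. rep (ae_class N (\<lambda>_. 1 :: real)) w = 1" by (rule rep_ae_class) simp
      with half have "ae_le N ?h \<one>\<^bsub>L0 N\<^esub>" unfolding one ae_le_def by eventually_elim simp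
      moreover have "\<xi> \<odot>\<^bsub>E\<^esub> ae_class M f \<oplus>\<^bsub>E\<^esub> (\<one>\<^bsub>L0 N\<^esub> \<ominus>\<^bsub>L0 N\<^esub> \<xi>) \<odot>\<^bsub>E\<^esub> ae_class M g \<in> B"
        if "\<xi> \<in> L0_nonneg N" "ae_le N \<xi> \<one>\<^bsub>L0 N\<^esub>" for \<xi>
        using conv f g that unfolding L0_convex_def by blast
      ultimately have B: "?h \<odot>\<^bsub>E\<^esub> ae_class M f \<oplus>\<^bsub>E\<^esub> ?h \<odot>\<^bsub>E\<^esub> ae_class M g \<in> B" by metis
      have fm[measurable]: "f \<in> borel_measurable M" and gm[measurable]: "g \<in> borel_measurable M" using f g by auto
      have c: "(\<lambda>_. 1/2) \<in> borel_measurable F" by simp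
      have m: "(\<lambda>w. 1/2 * f w) \<in> borel_measurable M" "(\<lambda>w. 1/2 * g w) \<in> borel_measurable M"
        "(\<lambda>w. (f w + g w) / 2) \<in> borel_measurable M" by measurable
      have "ae_class M (\<lambda>w. 1/2 * f w + 1/2 * g w) \<in> B"
        using B unfolding smult_class[OF c fm] smult_class[OF c gm] add_class[OF m(1,2)] .
      also have "(\<lambda>w. 1/2 * f w + 1/2 * g w) = (\<lambda>w. (f w + g w) / 2)" by (simp add: add_divide_distrib)
      finally show ?thesis using m(3) by simp
    qed
    show "glue_closed F {f \<in> borel_measurable M. ae_class M f \<in> B}"
      unfolding glue_closed_def
    proof (intro allI impI, elim conjE)
      fix f :: "nat \<Rightarrow> 'a \<Rightarrow> real" and i :: "'a \<Rightarrow> nat"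
      assume f: "\<forall>k. f k \<in> {f \<in> borel_measurable M. ae_class M f \<in> B}" and i[measurable]: "i \<in> measurable F (count_space UNIV)"
      have fm: "f k \<in> borel_measurable M" and fB: "ae_class M (f k) \<in> B" for k using f by auto
      have m: "(\<lambda>w. f (i w) w) \<in> borel_measurable M"
        using fm measurable_F[OF i] by (rule measurable_compose_countable)
      \<comment> \<open>The level sets of the index form the partition; some of them may be
        empty.\<close>
      define A where "A k = i -` {k} \<inter> space F" for k
      have A: "A k \<in> sets F" for k unfolding A_def by measurable
      have "range (\<lambda>k. ae_class M (f k)) \<subseteq> B" using fB by auto
      moreover have "range A \<subseteq> sets N" using A by (auto simp: sets_restr_to_subalg[OF sub])
      moreover have "disjoint_family A" by (auto simp: disjoint_family_on_def A_def)
      moreover have "(\<Union>n. A n) = space N" by (auto simp: A_def space_restr_to_subalg space_F)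
      ultimately obtain y where y: "y \<in> B" "\<And>n. L0_ind N (A n) \<odot>\<^bsub>E\<^esub> y = L0_ind N (A n) \<odot>\<^bsub>E\<^esub> ae_class M (f n)"
        using concat unfolding countable_concatenation_def by meson
      obtain g where g: "g \<in> borel_measurable M" "y = ae_class M g" using y(1) sub_E by (auto elim: carrier_cases)
      have "AE w in M. indicator (A n) w * g w = indicator (A n) w * f n w" for n
      proof -
        have [measurable]: "A n \<in> sets M" "g \<in> borel_measurable M" "f n \<in> borel_measurable M"
          using A sets_F g(1) fm by auto
        have ind: "(indicator (A n) :: 'a \<Rightarrow> real) \<in> borel_measurable F" using A by simp
        have "ae_class M (\<lambda>w. indicator (A n) w * g w) = ae_class M (\<lambda>w. indicator (A n) w * f n w)"
          using y(2)[of n] unfolding L0_ind_def g(2) smult_class[OF ind g(1)] smult_class[OF ind fm] .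
        then have "AE w in M. rep (ae_class M (\<lambda>w. indicator (A n) w * g w)) w = indicator (A n) w * f n w"
          using rep_ae_class[of "\<lambda>w. indicator (A n) w * f n w" M] by simp
        moreover have "AE w in M. rep (ae_class M (\<lambda>w. indicator (A n) w * g w)) w = indicator (A n) w * g w"
          by (rule rep_ae_class) measurable
        ultimately show ?thesis by eventually_elim simp
      qed
      then have "AE w in M. \<forall>n. indicator (A n) w * g w = indicator (A n) w * f n w"
        by (simp only: AE_all_countable) blast
      \<comment> \<open>At \<open>w\<close> the equation for the piece \<open>A (i w)\<close> is
        read off, where the indicator is 1.\<close>
      then have "AE w in M. g w = f (i w) w"
        using AE_space
      proof eventually_elim
        case (elim w)
        then show ?case using spec[OF elim(1), of "i w"] by (simp add: A_def space_F)
      qed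
      then have "ae_class M (\<lambda>w. f (i w) w) \<in> B" using y(1) g ae_class_eqI[OF g(1) m] by simp
      then show "(\<lambda>w. f (i w) w) \<in> {f \<in> borel_measurable M. ae_class M f \<in> B}" using m by simp
    qed
    show "f \<in> {f \<in> borel_measurable M. ae_class M f \<in> B}"
      if f: "f \<in> borel_measurable M"
        and ex: "\<And>e. e \<in> pos_functions F \<Longrightarrow> \<exists>u\<in>U. (\<lambda>w. f w + e w * u w) \<in> {f \<in> borel_measurable M. ae_class M f \<in> B}" for f
    proof -
      have class_U: "ae_class M (\<lambda>w. e w * u w) \<in> carrier E" 
          "ae_le N (Lp_norm M F p (ae_class M (\<lambda>w. e w * u w))) (L0_ennreal N (ae_class N e))"
        if e: "e \<in> pos_functions F" and u: "u \<in> U" for e u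
      proof -
        have "(\<lambda>w. e w * u w / e w) = u" using pos_functionsD(2)[OF e] by (simp add: less_imp_neq[symmetric])
        then have U: "(\<lambda>w. e w * u w / e w) \<in> U" using u by (simp only:)
        have m: "(\<lambda>w. e w * u w) \<in> borel_measurable M"
          using e u by (rule cond_ball_mult_measurable)
        show "ae_class M (\<lambda>w. e w * u w) \<in> carrier E" using m e U by (rule carrierI)
        show "ae_le N (Lp_norm M F p (ae_class M (\<lambda>w. e w * u w))) (L0_ennreal N (ae_class N e))"
          unfolding Lp_norm_le_iff[OF p m e] by (rule U)
      qed
      \<comment> \<open>Membership in the complement of \<open>B\<close> presupposes membership in
        the module; it follows from \<open>f = (f + u) - u\<close>.\<close>
      have fE: "ae_class M f \<in> carrier E"
      proof -
        have 1: "(\<lambda>_. 1) \<in> pos_functions F" by (simp add: pos_functions_const)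
        obtain u where u: "u \<in> U" and fu: "(\<lambda>w. f w + 1 * u w) \<in> {f \<in> borel_measurable M. ae_class M f \<in> B}"
          using ex[OF 1] by blast
        have um: "u \<in> borel_measurable M" using u by (simp add: cond_ball_def)
        have "(\<lambda>w. (-1) * u w) \<in> U" by (rule cond_ball_scale[OF u]) auto
        then have "ae_class M (\<lambda>w. 1 * ((-1) * u w)) \<in> carrier E" by (rule class_U(1)[OF 1])
        moreover have "ae_class M (\<lambda>w. f w + u w) \<in> carrier E" using fu sub_E by auto
        ultimately have "ae_class M (\<lambda>w. f w + u w) \<oplus>\<^bsub>E\<^esub> ae_class M (\<lambda>w. - u w) \<in> carrier E"
          by (simp add: carrier_add)
        then show ?thesis using f um by (simp add: add_class)
      qed
      \<comment> \<open>Otherwise some norm ball around \<open>f\<close> misses \<open>B\<close>,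
        while \<open>ex\<close> with the radius of that ball yields a point of \<open>B\<close> in
        it.\<close>
      have "ae_class M f \<in> B"
      proof (rule ccontr)
        assume "ae_class M f \<notin> B"
        then have "ae_class M f \<in> carrier E - B" using fE by simp
        moreover have "openin (Lp_topology M F p) (carrier E - B)"
          using closed by (simp add: closedin_def topspace_Lp)
        ultimately obtain X where "X \<in> L0_pos N"
          and X: "\<And>u. u \<in> carrier E \<Longrightarrow> ae_le N (Lp_norm M F p u) (L0_ennreal N X) \<Longrightarrow> ae_class M f \<oplus>\<^bsub>E\<^esub> u \<in> carrier E - B"
          unfolding openin_Lp by blast
        then obtain e where e: "e \<in> pos_functions F" "X = ae_class N e" by (auto elim: L0_pos_cases)
        obtain u where u: "u \<in> U" and fu: "(\<lambda>w. f w + e w * u w) \<in> {f \<in> borel_measurable M. ae_class M f \<in> B}"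
          using ex[OF e(1)] by blast
        have m: "(\<lambda>w. e w * u w) \<in> borel_measurable M"
          using e(1) u by (rule cond_ball_mult_measurable)
        have "ae_class M f \<oplus>\<^bsub>E\<^esub> ae_class M (\<lambda>w. e w * u w) \<in> carrier E - B"
          using X class_U[OF e(1) u] by (simp add: e(2))
        then show False using fu by (simp add: add_class[OF f m])
      qed
      then show ?thesis using f by simp
    qed
    show "\<exists>e\<in>pos_functions F. (\<lambda>w. e w * u w) \<in> {f \<in> borel_measurable M. ae_class M f \<in> B}" if u: "u \<in> U" for u
    proof -
      have um: "u \<in> borel_measurable M" using u by (simp add: cond_ball_def)
      have "ae_class M u \<in> carrier E" 
        using um by (rule carrierI[where e = "\<lambda>_. 1"]) (simp_all add: u pos_functions_const)
      then obtain X where "X \<in> L0_pos N"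
        and X: "\<And>\<eta>. \<eta> \<in> carrier (L0 N) \<Longrightarrow> ae_le N (L0_abs N \<eta>) X \<Longrightarrow> \<eta> \<odot>\<^bsub>E\<^esub> ae_class M u \<in> B"
        using abs unfolding L0_absorbent_def by blast
      then obtain e where e: "e \<in> pos_functions F" "X = ae_class N e" by (auto elim: L0_pos_cases)
      have em: "e \<in> borel_measurable F" using e by (auto dest: pos_functionsD)
      have "ae_class N e \<odot>\<^bsub>E\<^esub> ae_class M u \<in> B"
      proof (rule X)
        show "ae_class N e \<in> carrier (L0 N)" using pos_functions_borel_N[OF e(1)] by simp
        show "ae_le N (L0_abs N (ae_class N e)) X"
          unfolding e(2) using em em by (rule ae_le_abs) (simp add: less_imp_le[OF pos_functionsD(2)[OF e(1)]])
      qed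
      then show ?thesis using e(1) cond_ball_mult_measurable[OF e(1) u] by (auto simp: smult_class[OF em um])
    qed
  qed
qed

text \<open>The neighbourhood is the interior of \<open>B\<close>: the points around which some norm
  ball lies in \<open>B\<close>. At 0 the radius \<open>e\<close> works; openness comes from
  shrinking a radius to a quarter.\<close>

lemma neighbourhood_of_zeroI:
  assumes e: "e \<in> pos_functions F" and eB: "\<And>u. u \<in> U \<Longrightarrow> ae_class M (\<lambda>w. e w * u w) \<in> B" and sub_E: "B \<subseteq> carrier E"
  shows "\<exists>V. openin (Lp_topology M F p) V \<and> \<zero>\<^bsub>E\<^esub> \<in> V \<and> V \<subseteq> B"
proof -
  define V where "V = {x \<in> carrier E. \<exists>X\<in>L0_pos N. \<forall>u\<in>carrier E. ae_le N (Lp_norm M F p u) (L0_ennreal N X) \<longrightarrow> x \<oplus>\<^bsub>E\<^esub> u \<in> B}"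
  have "(\<lambda>w. 0 / e w) \<in> U" using cond_ball_zero by simp
  then have z: "\<zero>\<^bsub>E\<^esub> \<in> carrier E"
    unfolding zero_class using e by (intro carrierI) auto
  have norm_zero: "ae_le N (Lp_norm M F p \<zero>\<^bsub>E\<^esub>) (L0_ennreal N X)" if X: "X \<in> L0_pos N" for X
  proof -
    obtain d where d: "d \<in> pos_functions F" "X = ae_class N d" using X by (rule L0_pos_cases)
    show ?thesis unfolding zero_class d(2) by (subst Lp_norm_le_iff[OF p _ d(1)]) (simp_all add: cond_ball_zero)
  qed
  have r_zero: "x \<oplus>\<^bsub>E\<^esub> \<zero>\<^bsub>E\<^esub> = x" "\<zero>\<^bsub>E\<^esub> \<oplus>\<^bsub>E\<^esub> x = x" if "x \<in> carrier E" for x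
    using that by (auto elim!: carrier_cases simp: zero_class add_class)
  have "\<zero>\<^bsub>E\<^esub> \<in> V" unfolding V_def
  proof (intro CollectI conjI z bexI ballI impI)
    show "ae_class N e \<in> L0_pos N" using e by (rule ae_class_pos)
    fix u assume u: "u \<in> carrier E" and le: "ae_le N (Lp_norm M F p u) (L0_ennreal N (ae_class N e))"
    obtain g where g: "g \<in> borel_measurable M" "u = ae_class M g" using u by (rule carrier_cases)
    have "(\<lambda>w. g w / e w) \<in> U" using le Lp_norm_le_iff[OF p g(1) e] g(2) by simp
    then have "ae_class M (\<lambda>w. e w * (g w / e w)) \<in> B" by (rule eB)
    moreover have "(\<lambda>w. e w * (g w / e w)) = g" using pos_functionsD(2)[OF e] by (simp add: less_imp_neq[symmetric])
    ultimately show "\<zero>\<^bsub>E\<^esub> \<oplus>\<^bsub>E\<^esub> u \<in> B" using r_zero(2)[OF u] g(2) by simp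
  qed
  moreover have "V \<subseteq> B"
  proof
    fix x assume "x \<in> V"
    then obtain X where x: "x \<in> carrier E" and "X \<in> L0_pos N"
      "\<forall>u\<in>carrier E. ae_le N (Lp_norm M F p u) (L0_ennreal N X) \<longrightarrow> x \<oplus>\<^bsub>E\<^esub> u \<in> B" by (auto simp: V_def)
    then have "x \<oplus>\<^bsub>E\<^esub> \<zero>\<^bsub>E\<^esub> \<in> B" using z norm_zero by blast
    then show "x \<in> B" using r_zero(1)[OF x] by simp
  qed
  moreover have "openin (Lp_topology M F p) V"
    unfolding openin_Lp
  proof (intro conjI ballI)
    show "V \<subseteq> carrier E" by (auto simp: V_def)
    fix x assume "x \<in> V"
    then obtain X where x: "x \<in> carrier E" and "X \<in> L0_pos N"
      and X: "\<And>u. u \<in> carrier E \<Longrightarrow> ae_le N (Lp_norm M F p u) (L0_ennreal N X) \<Longrightarrow> x \<oplus>\<^bsub>E\<^esub> u \<in> B" by (auto simp: V_def)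
    then obtain d where d: "d \<in> pos_functions F" "X = ae_class N d" by (auto elim: L0_pos_cases)
    \<comment> \<open>Two displacements of norm at most \<open>d / 4\<close> add up to one of norm
      at most \<open>d\<close>, so each point within \<open>c\<close> of \<open>x\<close> keeps a
      ball of radius \<open>c\<close> inside \<open>B\<close>.\<close>
    define c where "c w = 1 / 4 * d w" for w
    have c: "c \<in> pos_functions F" unfolding c_def using d(1) by (rule pos_functions_cmult) simp
    have sum: "x \<oplus>\<^bsub>E\<^esub> u \<oplus>\<^bsub>E\<^esub> v \<in> B"
      if u: "u \<in> carrier E" "ae_le N (Lp_norm M F p u) (L0_ennreal N (ae_class N c))"
        and v: "v \<in> carrier E" "ae_le N (Lp_norm M F p v) (L0_ennreal N (ae_class N c))" for u v
    proof -
      obtain f where f: "f \<in> borel_measurable M" "u = ae_class M f" using u(1) by (rule carrier_cases)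
      obtain g where g: "g \<in> borel_measurable M" "v = ae_class M g" using v(1) by (rule carrier_cases)
      obtain h where h: "h \<in> borel_measurable M" "x = ae_class M h" using x by (rule carrier_cases)
      have m: "(\<lambda>w. f w + g w) \<in> borel_measurable M" "(\<lambda>w. h w + f w) \<in> borel_measurable M" using f g h by simp_all
      have "(\<lambda>w. (f w + g w) / d w) \<in> U"
      proof (rule cond_ball_add_quotient)
        show "(\<lambda>w. f w / (d w / 4)) \<in> U" using u(2) Lp_norm_le_iff[OF p f(1) c] f(2) by (simp add: c_def)
        show "(\<lambda>w. g w / (d w / 4)) \<in> U" using v(2) Lp_norm_le_iff[OF p g(1) c] g(2) by (simp add: c_def)
      qed
      then have "ae_le N (Lp_norm M F p (u \<oplus>\<^bsub>E\<^esub> v)) (L0_ennreal N X)"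
        using Lp_norm_le_iff[OF p m(1) d(1)] by (simp add: f(2) g(2) d(2) add_class[OF f(1) g(1)])
      then have "x \<oplus>\<^bsub>E\<^esub> (u \<oplus>\<^bsub>E\<^esub> v) \<in> B" using X carrier_add[OF u(1) v(1)] by blast
      then show ?thesis
        unfolding f(2) g(2) h(2) add_class[OF f(1) g(1)] add_class[OF h(1) f(1)] add_class[OF h(1) m(1)] add_class[OF m(2) g(1)]
        by (simp add: add.assoc)
    qed
    show "\<exists>X\<in>L0_pos N. \<forall>u\<in>carrier E. ae_le N (Lp_norm M F p u) (L0_ennreal N X) \<longrightarrow> x \<oplus>\<^bsub>E\<^esub> u \<in> V"
    proof (intro bexI ballI impI)
      show c': "ae_class N c \<in> L0_pos N" using c by (rule ae_class_pos)
      fix u assume u: "u \<in> carrier E" "ae_le N (Lp_norm M F p u) (L0_ennreal N (ae_class N c))"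
      show "x \<oplus>\<^bsub>E\<^esub> u \<in> V"
        unfolding V_def using carrier_add[OF x u(1)] sum[OF u] c' by blast
    qed
  qed
  ultimately show ?thesis by blast
qed

end

theorem corollary3p42:
  fixes M F :: "'a measure" and p :: ennreal
  assumes "prob_space M" and "subalgebra M F" and "1 \<le> p"
  shows "L0_pre_barreled (restr_to_subalg M F) (Lp_module M F p) (Lp_topology M F p)"
proof -
  interpret prob_space M by fact
  interpret Lp_subalgebra M F p by unfold_locales (rule assms)+
  show ?thesis
    unfolding L0_pre_barreled_def
  proof (intro allI impI, elim conjE)
    fix B assume B: "L0_barrel N E (Lp_topology M F p) B" "countable_concatenation N E B"
    \<comment> \<open>The barrel enters the function setting as the set of all measurable functions
      whose class lies in it.\<close>
    interpret module_barrel M F U "{f \<in> borel_measurable M. ae_class M f \<in> B}"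
      using B by (rule module_barrel_barrel)
    obtain e where e: "e \<in> pos_functions F" "\<And>u. u \<in> U \<Longrightarrow> ae_class M (\<lambda>w. e w * u w) \<in> B"
      using U_absorbed by blast
    moreover have "B \<subseteq> carrier E" using B(1) by (simp add: L0_barrel_def L0_balanced_def)
    ultimately show "\<exists>V. openin (Lp_topology M F p) V \<and> \<zero>\<^bsub>E\<^esub> \<in> V \<and> V \<subseteq> B"
      by (rule neighbourhood_of_zeroI)
  qed
qed

end
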